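(* Let $T:\mathbb{Z}^d\curvearrowright(X,\Sigma,\mu)$ be a $\mathbb{Z}^d$-system and let $\mu^{\mathrm F}$ be the Furstenberg self-joining of $T^{\mathbf e_1},\dots,T^{\mathbf e_d}$. If $A_1,\dots,A_d\in\Sigma$ satisfy $\mu^{\mathrm F}(A_1\times A_2\times\cdots\times A_d)=0$, then $\mu(A_1\cap A_2\cap\cdots\cap A_d)=0$.
   Context: A $\mathbb{Z}^d$-system is a standard Borel probability space $(X,\Sigma,\mu)$ with an action $T$ of $\mathbb{Z}^d$ by invertible measurable $\mu$-preserving maps; $\mathbf e_1,\dots,\mathbf e_d$ is the standard basis. The Furstenberg self-joining $\mu^{\mathrm F}$ is the probability measure on $(X^d,\Sigma^{\otimes d})$ determined by \[\mu^{\mathrm F}(A_1\times\cdots\times A_d)=\lim_{N\to\infty}\frac1N\sum_{n=1}^N\mu\big(T^{-n\mathbf e_1}(A_1)\cap\cdots\cap T^{-n\mathbf e_d}(A_d)\big)\] for all $A_1,\dots,A_d\in\Sigma$ (these limits exist). *)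

theory Defs
  imports "HOL-Probability.Probability"
begin

definition scaled_basis :: "nat \<Rightarrow> 'd \<Rightarrow> int ^ 'd" where
  "scaled_basis n i = (\<chi> j. if j = i then int n else 0)"

text \<open>A Z^d-system on a standard Borel probability space: the sigma algebra is the
Borel sigma algebra of a Polish space, M is a probability measure, and T is an
action of Z^d by measure-preserving maps (invertibility follows from the action law).\<close>
definition Zd_system :: "('a::polish_space) measure \<Rightarrow> (int ^ 'd \<Rightarrow> 'a \<Rightarrow> 'a) \<Rightarrow> bool" where
  "Zd_system M T \<longleftrightarrow>
     prob_space M \<and> sets M = sets borel \<and>
     (\<forall>x\<in>space M. T 0 x = x) \<and>
     (\<forall>m n. \<forall>x\<in>space M. T (m + n) x = T m (T n x)) \<and>
     (\<forall>n. T n \<in> measurable M M \<and> distr M M (T n) = M)"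

definition furstenberg_joining ::
  "'a measure \<Rightarrow> (int ^ 'd \<Rightarrow> 'a \<Rightarrow> 'a) \<Rightarrow> ('d \<Rightarrow> 'a) measure \<Rightarrow> bool" where
  "furstenberg_joining M T MF \<longleftrightarrow>
     prob_space MF \<and> sets MF = sets (PiM (UNIV :: 'd set) (\<lambda>_. M)) \<and>
     (\<forall>A :: 'd \<Rightarrow> 'a set. (\<forall>i. A i \<in> sets M) \<longrightarrow>
        ((\<lambda>N. (\<Sum>n=1..N. measure M (space M \<inter> (\<Inter>i. T (scaled_basis n i) -` A i))) / real N)
           \<longlonglongrightarrow> measure MF (PiE UNIV A)))"

end

(*
The theorem is equivalent to the multidimensional Szemeredi theorem in the form of Furstenberg and
Katznelson, which is deduced here from the density Hales-Jewett theorem.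

For a word x over the alphabet {1..d} of length m, and r >= 1, let T act by the sum of the vectors
r e_(x_i). If B = A_1 Int ... Int A_d has positive measure, then for many points the set of words
moving the point into B is dense and so contains a combinatorial line. A line with n wildcards
means a common return of B under the r n e_i, up to translation. Since m and all other constants
are independent of r, this gives a positive lower bound for the averages along all n.

The density Hales-Jewett theorem is proved by induction on the size of the alphabet, along the lines
of the proofs by Polymath and by Dodos, Kanellopoulos and Tyros. Instead of iterating a density
increment, one works at the critical density: a line-free set that is almost extremal is
equidistributed over the sections in few coordinates and admits no density increment.
*)

theory Submission
  imports Defs
begin

section \<open>Averages over finite sets\<close>

text \<open>The obstacle in proving density Hales-Jewett by a density increment is that the words of
  a random subspace are not uniformly distributed, so densities must be compared under two measures.
  At the critical density this difficulty disappears: a section over boundedly many coordinates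
  cannot exceed the average noticeably, or it would contain a line; hence none can fall far below
  it, and every distribution of the bounded coordinates sees the same density. This dictates the
  order of the constants: first the number r of these coordinates, then the distance e from the
  critical density, proportional to 1 / (k + 1) ^ r, and only then the dimension. The increment
  comes from a set \<open>D\<close> of density at least \<open>\<theta>\<close> that
  \<open>A\<close> almost misses, which leaves a total excess of about \<open>a * \<theta>\<close>
  for the complement. Structures found in a bounded cube for many values of the other coordinates
  are made independent of these by pigeonhole, at a cost depending on the bounded cube
  alone.\<close>

definition mean :: "'a set \<Rightarrow> ('a \<Rightarrow> real) \<Rightarrow> real" where
  "mean S f = (\<Sum>x\<in>S. f x) / real (card S)"

lemma mean_cong: "(\<And>x. x \<in> S \<Longrightarrow> f x = g x) \<Longrightarrow> mean S f = mean S g"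
  by (simp add: mean_def cong: sum.cong)

lemma mean_mono: "(\<And>x. x \<in> S \<Longrightarrow> f x \<le> g x) \<Longrightarrow> mean S f \<le> mean S g"
  by (simp add: mean_def divide_right_mono sum_mono)

lemma mean_add: "mean S (\<lambda>x. f x + g x) = mean S f + mean S g"
  by (simp add: mean_def sum.distrib add_divide_distrib)

lemma mean_diff: "mean S (\<lambda>x. f x - g x) = mean S f - mean S g"
  by (simp add: mean_def sum_subtractf diff_divide_distrib)

lemma mean_cmult: "mean S (\<lambda>x. c * f x) = c * mean S f"
  by (simp add: mean_def sum_distrib_left[symmetric])

lemma mean_multc: "mean S (\<lambda>x. f x * c) = mean S f * c"
  by (simp add: mean_def sum_distrib_right[symmetric])

lemma mean_sum: "mean S (\<lambda>x. \<Sum>i\<in>T. f i x) = (\<Sum>i\<in>T. mean S (f i))"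
  unfolding mean_def by (subst sum.swap) (simp add: sum_divide_distrib)

lemma mean_const: "finite S \<Longrightarrow> S \<noteq> {} \<Longrightarrow> mean S (\<lambda>_. c) = c"
  by (simp add: mean_def)

lemma mean_swap: "mean S (\<lambda>x. mean T (f x)) = mean T (\<lambda>y. mean S (\<lambda>x. f x y))"
  unfolding mean_def sum_divide_distrib[symmetric]
  by (subst sum.swap) (simp add: mult.commute)

lemma mean_Times: "mean (S \<times> T) f = mean S (\<lambda>x. mean T (\<lambda>y. f (x, y)))"
  unfolding mean_def sum_divide_distrib[symmetric]
  by (simp add: sum.cartesian_product card_cartesian_product mult.commute)

lemma mean_reindex:
  assumes "bij_betw h S T"
  shows "mean T f = mean S (\<lambda>x. f (h x))"
  using sum.reindex_bij_betw[OF assms, of f] bij_betw_same_card[OF assms]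
  by (simp add: mean_def)

lemma mean_ge_imp_ex:
  assumes "finite S" "S \<noteq> {}" "b \<le> mean S f"
  shows "\<exists>x\<in>S. b \<le> f x"
proof (rule ccontr)
  assume "\<not> ?thesis"
  then have "(\<Sum>x\<in>S. f x) < (\<Sum>x\<in>S. b)"
    using assms by (intro sum_strict_mono) auto
  then have "mean S f < b"
    using assms by (simp add: mean_def divide_less_eq card_gt_0_iff mult.commute)
  then show False using assms by simp
qed

lemma mean_of_bool_le_1: "mean S (\<lambda>x. of_bool (P x)) \<le> 1"
proof (cases "finite S \<and> S \<noteq> {}")
  case True
  have "mean S (\<lambda>x. of_bool (P x)) \<le> mean S (\<lambda>_. 1)"
    by (rule mean_mono) simp
  then show ?thesis using True by (simp add: mean_const)
qed (auto simp: mean_def)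

lemma mean_nonneg: "(\<And>x. x \<in> S \<Longrightarrow> 0 \<le> f x) \<Longrightarrow> 0 \<le> mean S f"
  by (simp add: mean_def sum_nonneg)

text \<open>Reverse Markov inequality: where \<open>f x\<close> is below \<open>b / 2\<close> it
  contributes at most \<open>b / 2\<close>, elsewhere at most 1.\<close>

lemma mean_large_values:
  assumes "finite S" "S \<noteq> {}" "0 \<le> b" "b \<le> mean S f" "\<And>x. x \<in> S \<Longrightarrow> f x \<le> 1"
  shows "b / 2 \<le> mean S (\<lambda>x. of_bool (b / 2 \<le> f x))"
proof -
  have "mean S f \<le> mean S (\<lambda>x. b / 2 + of_bool (b / 2 \<le> f x))"
  proof (rule mean_mono)
    fix x assume "x \<in> S"
    with assms(5)[OF this] assms(3) show "f x \<le> b / 2 + of_bool (b / 2 \<le> f x)"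
      by auto
  qed
  then show ?thesis using assms by (simp add: mean_add mean_const)
qed

text \<open>The loss \<open>2 ^ card X\<close> does not depend on \<open>Y\<close>, which will be far larger than \<open>X\<close>.\<close>

lemma popular_subset:
  assumes X: "finite X" "X \<noteq> {}" and Y: "finite Y" "Y \<noteq> {}" and b: "0 < b"
    and dens: "b \<le> mean Y (\<lambda>y. mean X (\<lambda>x. of_bool (R x y)))"
    and ex: "\<And>y. y \<in> Y \<Longrightarrow> b / 2 \<le> mean X (\<lambda>x. of_bool (R x y)) \<Longrightarrow>
               \<exists>U\<subseteq>X. Q U \<and> (\<forall>u\<in>U. R u y)"
  shows "\<exists>U\<subseteq>X. Q U \<and> b / 2 / 2 ^ card X \<le> mean Y (\<lambda>y. of_bool (\<forall>u\<in>U. R u y))"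
proof (rule ccontr)
  define F where "F = {U. U \<subseteq> X \<and> Q U}"
  have F: "finite F" and F_le: "card F \<le> 2 ^ card X"
    using X card_mono[of "Pow X" F] by (auto simp: F_def card_Pow)
  assume "\<not> ?thesis"
  then have small: "mean Y (\<lambda>y. of_bool (\<forall>u\<in>U. R u y)) < b / 2 / 2 ^ card X" if "U \<in> F" for U
    using that by (auto simp: F_def not_le)
  have "b / 2 \<le> mean Y (\<lambda>y. of_bool (b / 2 \<le> mean X (\<lambda>x. of_bool (R x y))))"
    by (rule mean_large_values[OF Y less_imp_le[OF b] dens mean_of_bool_le_1])
  \<comment> \<open>Every \<open>y\<close> with a dense fibre is charged to some \<open>U\<close> in
    \<open>F\<close>. If all of these at most \<open>2 ^ card X\<close> sets were unpopular, too few
    \<open>y\<close> would be accounted for.\<close>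
  also have "\<dots> \<le> mean Y (\<lambda>y. \<Sum>U\<in>F. of_bool (\<forall>u\<in>U. R u y))"
  proof (rule mean_mono)
    fix y assume y: "y \<in> Y"
    show "of_bool (b / 2 \<le> mean X (\<lambda>x. of_bool (R x y))) \<le> (\<Sum>U\<in>F. of_bool (\<forall>u\<in>U. R u y) :: real)"
    proof (cases "b / 2 \<le> mean X (\<lambda>x. of_bool (R x y))")
      case True
      then obtain U where U: "U \<in> F" "\<forall>u\<in>U. R u y" using ex[OF y] by (auto simp: F_def)
      have "(1::real) = of_bool (\<forall>u\<in>U. R u y)" using U by simp
      also have "\<dots> \<le> (\<Sum>U\<in>F. of_bool (\<forall>u\<in>U. R u y))"
        by (rule member_le_sum) (use U F in auto)
      finally show ?thesis using True by simp
    qed (simp add: sum_nonneg)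
  qed
  also have "\<dots> = (\<Sum>U\<in>F. mean Y (\<lambda>y. of_bool (\<forall>u\<in>U. R u y)))" by (rule mean_sum)
  finally have *: "b / 2 \<le> (\<Sum>U\<in>F. mean Y (\<lambda>y. of_bool (\<forall>u\<in>U. R u y)))" .
  then have ne: "F \<noteq> {}" using b by auto
  have "(\<Sum>U\<in>F. mean Y (\<lambda>y. of_bool (\<forall>u\<in>U. R u y))) < (\<Sum>U\<in>F. b / 2 / 2 ^ card X)"
    by (rule sum_strict_mono[OF F ne small])
  also have "\<dots> = real (card F) * (b / 2 / 2 ^ card X)" by simp
  also have "\<dots> \<le> 2 ^ card X * (b / 2 / 2 ^ card X)"
    using F_le b by (intro mult_right_mono) (simp_all add: of_nat_le_iff[of _ "2 ^ card X", where 'a=real, simplified])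
  also have "\<dots> = b / 2" by simp
  finally show False using * by simp
qed

section \<open>Words and combinatorial subspaces\<close>

text \<open>Words with coordinates in \<open>I\<close> are functions on all of \<open>nat\<close> that vanish off \<open>I\<close>, so that
  \<open>cube k I\<close> has \<open>k ^ card I\<close> elements.\<close>

definition cube :: "nat \<Rightarrow> nat set \<Rightarrow> (nat \<Rightarrow> nat) set" where
  "cube k I = PiE_dflt I 0 (\<lambda>_. {..<k})"

lemma mem_cube: "x \<in> cube k I \<longleftrightarrow> (\<forall>i. (i \<in> I \<longrightarrow> x i < k) \<and> (i \<notin> I \<longrightarrow> x i = 0))"
  by (simp add: cube_def PiE_dflt_def)

lemma finite_cube: "finite I \<Longrightarrow> finite (cube k I)"
  by (simp add: cube_def finite_PiE_dflt)

lemma card_cube: "finite I \<Longrightarrow> card (cube k I) = k ^ card I"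
  by (simp add: cube_def card_PiE_dflt)

lemma cube_ne: "0 < k \<Longrightarrow> cube k I \<noteq> {}"
  using mem_cube[of "\<lambda>_. 0" k I] by auto

lemma cube_mono: "k \<le> l \<Longrightarrow> cube k I \<subseteq> cube l I"
  by (force simp: mem_cube)

definition glue :: "nat set \<Rightarrow> (nat \<Rightarrow> nat) \<Rightarrow> (nat \<Rightarrow> nat) \<Rightarrow> nat \<Rightarrow> nat" where
  "glue I x y = (\<lambda>i. if i \<in> I then x i else y i)"

lemma cube_less: "x \<in> cube k I \<Longrightarrow> i \<in> I \<Longrightarrow> x i < k"
  and cube_0: "x \<in> cube k I \<Longrightarrow> i \<notin> I \<Longrightarrow> x i = 0"
  by (simp_all add: mem_cube)

lemma cubeI: "(\<And>i. i \<in> I \<Longrightarrow> x i < k) \<Longrightarrow> (\<And>i. i \<notin> I \<Longrightarrow> x i = 0) \<Longrightarrow> x \<in> cube k I"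
  by (simp add: mem_cube)

lemma bij_betw_glue:
  assumes "I \<inter> J = {}"
  shows "bij_betw (\<lambda>(x, y). glue I x y) (cube k I \<times> cube k J) (cube k (I \<union> J))"
proof -
  define r where "r I z i = (if i \<in> I then z i else 0)" for I and z :: "nat \<Rightarrow> nat" and i
  have 1: "r I (glue I x y) = x" if "x \<in> cube k I" for x y
    using cube_0[OF that] by (simp add: fun_eq_iff r_def glue_def)
  have 2: "r J (glue I x y) = y" if "y \<in> cube k J" for x y
  proof
    fix i show "r J (glue I x y) i = y i"
      using cube_0[OF that, of i] assms by (cases "i \<in> I"; cases "i \<in> J") (auto simp: r_def glue_def)
  qed
  have 3: "glue I (r I z) (r J z) = z" if "z \<in> cube k (I \<union> J)" for z
  proof
    fix i show "glue I (r I z) (r J z) i = z i"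
      using cube_0[OF that, of i] by (cases "i \<in> I"; cases "i \<in> J") (simp_all add: r_def glue_def)
  qed
  have 4: "r I z \<in> cube k I" "r J z \<in> cube k J" if "z \<in> cube k (I \<union> J)" for z
    using cube_less[OF that] by (auto intro!: cubeI simp: r_def)
  have 5: "glue I x y \<in> cube k (I \<union> J)" if "x \<in> cube k I" "y \<in> cube k J" for x y
    using cube_less[OF that(1)] cube_less[OF that(2)] cube_0[OF that(2)] by (auto intro!: cubeI simp: glue_def split: if_splits)
  show ?thesis
    by (rule bij_betw_byWitness[where f' = "\<lambda>z. (r I z, r J z)"]) (use 1 2 3 4 5 in auto)
qed

lemma glue_in_cube: "I \<inter> J = {} \<Longrightarrow> x \<in> cube k I \<Longrightarrow> y \<in> cube k J \<Longrightarrow> glue I x y \<in> cube k (I \<union> J)"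
  using bij_betwE[OF bij_betw_glue, of I J k] by (metis (no_types, lifting) SigmaI case_prod_conv)

lemma mean_cube_Un:
  assumes "I \<inter> J = {}"
  shows "mean (cube k (I \<union> J)) f = mean (cube k I) (\<lambda>x. mean (cube k J) (\<lambda>y. f (glue I x y)))"
  by (subst mean_reindex[OF bij_betw_glue[OF assms]]) (simp add: mean_Times)

lemma mean_cube_singleton: "mean (cube k {i}) f = mean {..<k} (\<lambda>a. f (\<lambda>j. if j = i then a else 0))"
proof (rule mean_reindex)
  show "bij_betw (\<lambda>a j. if j = i then a else 0) {..<k} (cube k {i})"
    by (rule bij_betw_byWitness[where f' = "\<lambda>x. x i"]) (auto simp: mem_cube fun_eq_iff)
qed

lemma mean_cube_prod:
  assumes "finite I"
  shows "mean (cube k I) (\<lambda>x. \<Prod>i\<in>I. h (x i)) = mean {..<k} h ^ card I"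
  using assms
proof (induction I)
  case empty
  have "cube k {} = {\<lambda>_. 0}" by (auto simp: mem_cube)
  then show ?case by (simp add: mean_def)
next
  case (insert j I)
  have "mean (cube k (insert j I)) (\<lambda>x. \<Prod>i\<in>insert j I. h (x i))
      = mean (cube k {j}) (\<lambda>x. mean (cube k I) (\<lambda>y. h (x j) * (\<Prod>i\<in>I. h (y i))))"
  proof -
    have "(\<Prod>i\<in>I. h (glue {j} x y i)) = (\<Prod>i\<in>I. h (y i))" for x y
      using insert by (intro prod.cong) (auto simp: glue_def)
    then have "(\<Prod>i\<in>insert j I. h (glue {j} x y i)) = h (x j) * (\<Prod>i\<in>I. h (y i))" for x y
      using insert by (simp add: glue_def)
    moreover have "{j} \<inter> I = {}" using insert(2) by simp
    ultimately show ?thesis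
      using mean_cube_Un[of "{j}" I k "\<lambda>x. \<Prod>i\<in>insert j I. h (x i)"] by (simp only: insert_is_Un[of j I, symmetric])
  qed
  also have "\<dots> = mean (cube k {j}) (\<lambda>x. h (x j) * mean {..<k} h ^ card I)"
    by (simp only: mean_cmult insert.IH)
  also have "\<dots> = mean {..<k} h * mean {..<k} h ^ card I"
    by (simp only: mean_multc mean_cube_singleton if_True refl)
  finally show ?case unfolding card_insert_disjoint[OF insert(1,2)] power_Suc .
qed

text \<open>Exponential moment bound, with \<open>(1/2) ^ X\<close> for the number \<open>X\<close> of coordinates in \<open>L\<close>.\<close>

lemma few_occurrences:
  assumes l: "l < k" "L l" and e: "0 < e"
  shows "\<exists>N. \<forall>I. finite I \<longrightarrow> N \<le> card I \<longrightarrow>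
           mean (cube k I) (\<lambda>x. of_bool (card {i \<in> I. L (x i)} < n)) \<le> e"
proof -
  define h :: "nat \<Rightarrow> real" where "h a = (if L a then 1/2 else 1)" for a
  define \<rho> where "\<rho> = mean {..<k} h"
  have "(\<Sum>a<k. h a) < (\<Sum>a<k. 1)"
    by (rule sum_strict_mono_ex1) (use l in \<open>auto simp: h_def intro: bexI[of _ l]\<close>)
  then have rho: "0 \<le> \<rho>" "\<rho> < 1"
    using l by (auto simp: \<rho>_def mean_def h_def intro!: sum_nonneg divide_nonneg_nonneg)
  then obtain N where N: "\<rho> ^ N < e / 2 ^ n"
    using real_arch_pow_inv[of "e / 2 ^ n" \<rho>] e by auto
  have "mean (cube k I) (\<lambda>x. of_bool (card {i \<in> I. L (x i)} < n)) \<le> e"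
    if I: "finite I" "N \<le> card I" for I
  proof -
    have prod: "(\<Prod>i\<in>I. h (x i)) = (1/2) ^ card {i \<in> I. L (x i)}" for x
      using I by (simp add: h_def prod.If_cases Int_def)
    \<comment> \<open>Markov's inequality: with fewer than \<open>n\<close> coordinates in
      \<open>L\<close> the product of the weights exceeds \<open>(1/2) ^ n\<close>.\<close>
    have "mean (cube k I) (\<lambda>x. of_bool (card {i \<in> I. L (x i)} < n))
        \<le> mean (cube k I) (\<lambda>x. 2 ^ n * (\<Prod>i\<in>I. h (x i)))"
    proof (rule mean_mono)
      fix x
      show "of_bool (card {i \<in> I. L (x i)} < n) \<le> 2 ^ n * (\<Prod>i\<in>I. h (x i))"
      proof (cases "card {i \<in> I. L (x i)} < n")
        case True
        then have "(1::real) \<le> 2 ^ (n - card {i \<in> I. L (x i)})" by simp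
        also have "\<dots> = 2 ^ n * (1/2) ^ card {i \<in> I. L (x i)}"
          using True by (simp add: power_diff power_divide)
        finally show ?thesis using True by (simp add: prod)
      qed (simp add: prod)
    qed
    also have "\<dots> = 2 ^ n * \<rho> ^ card I"
      using I by (simp add: mean_cmult mean_cube_prod \<rho>_def)
    also have "\<dots> \<le> 2 ^ n * \<rho> ^ N"
      using I rho by (intro mult_left_mono power_decreasing) auto
    also have "\<dots> \<le> e" using N by (simp add: field_simps)
    finally show ?thesis .
  qed
  then show ?thesis by blast
qed

text \<open>A combinatorial subspace of \<open>cube k I\<close> is given by a word over letters \<open>Inl a\<close> and wildcards
  \<open>Inr j\<close> with \<open>j \<in> J\<close>, each of them occurring; it is the range of \<open>inst \<tau>\<close> on \<open>cube k J\<close>. Lines are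
  the case \<open>J = {0}\<close>. A template over \<open>k\<close> letters is also one over \<open>Suc k\<close> letters.\<close>

definition template :: "nat \<Rightarrow> nat set \<Rightarrow> nat set \<Rightarrow> (nat \<Rightarrow> nat + nat) \<Rightarrow> bool" where
  "template k J I \<tau> \<longleftrightarrow>
     (\<forall>i a. \<tau> i = Inl a \<longrightarrow> (if i \<in> I then a < k else a = 0)) \<and>
     (\<forall>i j. \<tau> i = Inr j \<longrightarrow> i \<in> I \<and> j \<in> J) \<and>
     (\<forall>j\<in>J. \<exists>i. \<tau> i = Inr j)"

definition inst :: "(nat \<Rightarrow> nat + nat) \<Rightarrow> (nat \<Rightarrow> nat) \<Rightarrow> nat \<Rightarrow> nat" where
  "inst \<tau> w = (\<lambda>i. case \<tau> i of Inl a \<Rightarrow> a | Inr j \<Rightarrow> w j)"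

text \<open>Composition of the subspace maps (see \<open>inst_tcomp\<close>), so that a subspace of
  a subspace is again one.\<close>

definition tcomp :: "(nat \<Rightarrow> nat + nat) \<Rightarrow> (nat \<Rightarrow> nat + nat) \<Rightarrow> nat \<Rightarrow> nat + nat" where
  "tcomp \<tau> \<sigma> = (\<lambda>i. case \<tau> i of Inl a \<Rightarrow> Inl a | Inr j \<Rightarrow> \<sigma> j)"

lemma inst_tcomp: "inst (tcomp \<tau> \<sigma>) w = inst \<tau> (inst \<sigma> w)"
  by (auto simp: inst_def tcomp_def split: sum.splits)

lemma template_Inl: "template k J I \<tau> \<Longrightarrow> \<tau> i = Inl a \<Longrightarrow> (if i \<in> I then a < k else a = 0)"
  and template_Inr: "template k J I \<tau> \<Longrightarrow> \<tau> i = Inr j \<Longrightarrow> i \<in> I \<and> j \<in> J"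
  and template_ex: "template k J I \<tau> \<Longrightarrow> j \<in> J \<Longrightarrow> \<exists>i. \<tau> i = Inr j"
  by (simp_all add: template_def)

lemma template_tcomp:
  assumes "template k J I \<tau>" "template k L J \<sigma>"
  shows "template k L I (tcomp \<tau> \<sigma>)"
  unfolding template_def
proof (intro conjI allI impI ballI)
  fix i a assume a: "tcomp \<tau> \<sigma> i = Inl a"
  show "if i \<in> I then a < k else a = 0"
  proof (cases "\<tau> i")
    case (Inl b)
    then show ?thesis using a template_Inl[OF assms(1) Inl] by (simp add: tcomp_def split: if_splits)
  next
    case (Inr j)
    then show ?thesis
      using a template_Inr[OF assms(1) Inr] template_Inl[OF assms(2), of j a] by (simp add: tcomp_def)
  qed
next
  fix i l assume l: "tcomp \<tau> \<sigma> i = Inr l"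
  then obtain j where j: "\<tau> i = Inr j" "\<sigma> j = Inr l" by (auto simp: tcomp_def split: sum.splits)
  show "i \<in> I" "l \<in> L" using template_Inr[OF assms(1) j(1)] template_Inr[OF assms(2) j(2)] by simp_all
next
  fix l assume "l \<in> L"
  then obtain j where j: "\<sigma> j = Inr l" using template_ex[OF assms(2)] by blast
  then have "j \<in> J" using template_Inr[OF assms(2)] by blast
  then obtain i where "\<tau> i = Inr j" using template_ex[OF assms(1)] by blast
  with j show "\<exists>i. tcomp \<tau> \<sigma> i = Inr l" by (intro exI[of _ i]) (simp add: tcomp_def)
qed

lemma inst_in_cube: "template k J I \<tau> \<Longrightarrow> w \<in> cube k J \<Longrightarrow> inst \<tau> w \<in> cube k I"
  by (simp add: template_def mem_cube inst_def split: sum.split)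

lemma inj_on_inst:
  assumes "template k J I \<tau>"
  shows "inj_on (inst \<tau>) (cube k J)"
proof (rule inj_onI, rule ext)
  fix v w j assume vw: "v \<in> cube k J" "w \<in> cube k J" "inst \<tau> v = inst \<tau> w"
  show "v j = w j"
  proof (cases "j \<in> J")
    case True
    then obtain i where "\<tau> i = Inr j" using assms by (auto simp: template_def)
    then show ?thesis using fun_cong[OF vw(3), of i] by (simp add: inst_def)
  qed (use vw in \<open>auto simp: mem_cube\<close>)
qed

text \<open>The section through \<open>y\<close>, encoded as a subspace in which every coordinate of
  \<open>I\<close> is its own wildcard, so that sections and subspaces compose.\<close>

definition fill :: "nat set \<Rightarrow> (nat \<Rightarrow> nat) \<Rightarrow> nat \<Rightarrow> nat + nat" where
  "fill I y = (\<lambda>i. if i \<in> I then Inr i else Inl (y i))"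

lemma inst_fill: "inst (fill I y) x = glue I x y"
  by (auto simp: inst_def fill_def glue_def)

lemma template_fill: "I \<inter> J = {} \<Longrightarrow> y \<in> cube k J \<Longrightarrow> template k I (I \<union> J) (fill I y)"
  by (auto simp: template_def fill_def mem_cube)

text \<open>Constant assignments stand for the words of \<open>cube k {0}\<close>: only their value
  at the single wildcard 0 matters.\<close>

definition has_line :: "nat \<Rightarrow> nat set \<Rightarrow> ((nat \<Rightarrow> nat) \<Rightarrow> bool) \<Rightarrow> bool" where
  "has_line k I A \<longleftrightarrow> (\<exists>\<tau>. template k {0} I \<tau> \<and> (\<forall>a<k. A (inst \<tau> (\<lambda>_. a))))"

lemma has_line_inst:
  assumes "template k J I \<sigma>" "has_line k J (\<lambda>w. A (inst \<sigma> w))"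
  shows "has_line k I A"
proof -
  obtain \<tau> where \<tau>: "template k {0} J \<tau>" "\<forall>a<k. A (inst \<sigma> (inst \<tau> (\<lambda>_. a)))"
    using assms(2) by (auto simp: has_line_def)
  then show ?thesis
    unfolding has_line_def
    by (intro exI[of _ "tcomp \<sigma> \<tau>"]) (simp add: inst_tcomp template_tcomp[OF assms(1)])
qed

text \<open>\<open>N\<close> serves all finite index sets, not just initial segments, because later
  cubes live on subsets of \<open>I\<close>. A density above 1 is allowed and makes the statement
  vacuous.\<close>

definition dhj :: "nat \<Rightarrow> real \<Rightarrow> bool" where
  "dhj k b \<longleftrightarrow> (\<exists>N. \<forall>I A. finite I \<longrightarrow> N \<le> card I \<longrightarrow>
     b \<le> mean (cube k I) (\<lambda>x. of_bool (A x)) \<longrightarrow> has_line k I A)"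

lemma mean_cube_split:
  assumes "I1 \<subseteq> I"
  shows "mean (cube k I) f = mean (cube k (I - I1)) (\<lambda>y. mean (cube k I1) (\<lambda>x. f (glue I1 x y)))"
proof -
  have "I1 \<union> (I - I1) = I" using assms by blast
  then have "mean (cube k I) f = mean (cube k I1) (\<lambda>x. mean (cube k (I - I1)) (\<lambda>y. f (glue I1 x y)))"
    using mean_cube_Un[of I1 "I - I1" k f] by simp
  then show ?thesis by (subst mean_swap)
qed

lemma template_fill': "I1 \<subseteq> I \<Longrightarrow> y \<in> cube k (I - I1) \<Longrightarrow> template k I1 I (fill I1 y)"
  using template_fill[of I1 "I - I1" y k] by (simp add: Un_absorb1)

lemma glue_in_cube': "I1 \<subseteq> I \<Longrightarrow> x \<in> cube k I1 \<Longrightarrow> y \<in> cube k (I - I1) \<Longrightarrow> glue I1 x y \<in> cube k I"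
  using glue_in_cube[of I1 "I - I1" x k y] by (simp add: Un_absorb1)

lemma template_mono: "template k J I \<tau> \<Longrightarrow> k \<le> l \<Longrightarrow> template l J I \<tau>"
  unfolding template_def by (meson less_le_trans)

lemma inst_line_in_cube:
  assumes "template k {0} I \<tau>" "a < k"
  shows "inst \<tau> (\<lambda>_. a) \<in> cube k I"
proof -
  have "inst \<tau> (\<lambda>_. a) = inst \<tau> (\<lambda>i. if i = 0 then a else 0)"
    using template_Inr[OF assms(1)] by (auto simp: inst_def fun_eq_iff split: sum.splits)
  also have "\<dots> \<in> cube k I"
    by (rule inst_in_cube[OF assms(1)]) (use assms(2) in \<open>simp add: mem_cube\<close>)
  finally show ?thesis .
qed

section \<open>From lines to subspaces\<close>

definition mdhj :: "nat \<Rightarrow> nat \<Rightarrow> real \<Rightarrow> bool" where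
  "mdhj k m b \<longleftrightarrow> (\<exists>N. \<forall>I J A. finite I \<longrightarrow> N \<le> card I \<longrightarrow> finite J \<longrightarrow> card J = m \<longrightarrow>
     b \<le> mean (cube k I) (\<lambda>x. of_bool (A x)) \<longrightarrow>
     (\<exists>\<tau>. template k J I \<tau> \<and> (\<forall>w\<in>cube k J. A (inst \<tau> w))))"

text \<open>Induction on the dimension: a bounded block \<open>I1\<close> contains a line for many
  words \<open>y\<close> on the other coordinates, by pigeonhole the same line, and the set of these
  \<open>y\<close> contains a subspace of one dimension less.\<close>

lemma mdhj_of_dhj:
  assumes k: "0 < k" and dhj: "\<And>b. 0 < b \<Longrightarrow> dhj k b" and b: "0 < b"
  shows "mdhj k m b"
  using b
proof (induction m arbitrary: b)
  case 0
  have "\<exists>\<tau>. template k J I \<tau> \<and> (\<forall>w\<in>cube k J. A (inst \<tau> w))"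
    if I: "finite I" and J: "finite J" "card J = 0" and A: "b \<le> mean (cube k I) (\<lambda>x. of_bool (A x))"
    for I J :: "nat set" and A
  proof -
    from J have [simp]: "J = {}" by simp
    obtain x where x: "x \<in> cube k I" "b \<le> of_bool (A x)"
      using mean_ge_imp_ex[OF finite_cube[OF I] cube_ne[OF k] A] by blast
    have "template k {} I (fill {} x)" using template_fill'[of "{}" I x k] x by simp
    moreover have "A (inst (fill {} x) w)" for w
    proof -
      have "A x" using x 0 by (cases "A x") auto
      then show ?thesis by (simp add: inst_fill glue_def)
    qed
    ultimately show ?thesis by auto
  qed
  then show ?case unfolding mdhj_def by blast
next
  case (Suc m)
  obtain N1 where N1: "\<And>I A. finite I \<Longrightarrow> N1 \<le> card I \<Longrightarrow>
      b / 2 \<le> mean (cube k I) (\<lambda>x. of_bool (A x)) \<Longrightarrow> has_line k I A"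
    using dhj[of "b / 2"] Suc.prems by (auto simp: dhj_def)
  \<comment> \<open>The density that \<open>popular_subset\<close> leaves for a cube of
    \<open>k ^ N1\<close> words. It does not depend on \<open>I\<close>, so \<open>N2\<close> may be
    chosen after it.\<close>
  define c where "c = b / 2 / 2 ^ (k ^ N1)"
  have "0 < c" using Suc.prems by (simp add: c_def)
  from Suc.IH[OF this] obtain N2 where N2: "\<And>I J A. finite I \<Longrightarrow> N2 \<le> card I \<Longrightarrow> finite J \<Longrightarrow> card J = m \<Longrightarrow>
      c \<le> mean (cube k I) (\<lambda>x. of_bool (A x)) \<Longrightarrow>
      \<exists>\<tau>. template k J I \<tau> \<and> (\<forall>w\<in>cube k J. A (inst \<tau> w))"
    unfolding mdhj_def by blast
  have *: "\<exists>\<tau>. template k J I \<tau> \<and> (\<forall>w\<in>cube k J. A (inst \<tau> w))"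
    if I: "finite I" "N1 + N2 \<le> card I" and J: "finite J" "card J = Suc m"
      and A: "b \<le> mean (cube k I) (\<lambda>x. of_bool (A x))" for I J A
  proof -
    obtain I1 where I1: "I1 \<subseteq> I" "card I1 = N1" "finite I1"
      using obtain_subset_with_card_n[of N1 I] I by (metis add_leD1)
    define I2 where "I2 = I - I1"
    have I2: "finite I2" "N2 \<le> card I2"
      using I I1 by (auto simp: I2_def card_Diff_subset)
    obtain j where j: "j \<in> J" using J by fastforce
    define J' where "J' = J - {j}"
    have J': "finite J'" "card J' = m" using J j by (auto simp: J'_def)
    have "\<exists>U\<subseteq>cube k I1. (\<exists>\<sigma>. template k {0} I1 \<sigma> \<and> U = (\<lambda>a. inst \<sigma> (\<lambda>_. a)) ` {..<k}) \<and>
       b / 2 / 2 ^ card (cube k I1) \<le> mean (cube k I2) (\<lambda>y. of_bool (\<forall>u\<in>U. A (glue I1 u y)))"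
    proof (rule popular_subset[OF finite_cube[OF I1(3)] cube_ne[OF k] finite_cube[OF I2(1)] cube_ne[OF k] Suc.prems])
      show "b \<le> mean (cube k I2) (\<lambda>y. mean (cube k I1) (\<lambda>x. of_bool (A (glue I1 x y))))"
        using A unfolding I2_def by (subst (asm) mean_cube_split[OF I1(1)])
      fix y assume "b / 2 \<le> mean (cube k I1) (\<lambda>x. of_bool (A (glue I1 x y)))"
      from N1[OF I1(3) _ this] I1(2) obtain \<sigma> where
        \<sigma>: "template k {0} I1 \<sigma>" "\<forall>a<k. A (glue I1 (inst \<sigma> (\<lambda>_. a)) y)"
        by (auto simp: has_line_def)
      have "(\<lambda>a. inst \<sigma> (\<lambda>_. a)) ` {..<k} \<subseteq> cube k I1"
        using inst_line_in_cube[OF \<sigma>(1)] by blast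
      with \<sigma> show "\<exists>U\<subseteq>cube k I1. (\<exists>\<sigma>. template k {0} I1 \<sigma> \<and> U = (\<lambda>a. inst \<sigma> (\<lambda>_. a)) ` {..<k}) \<and>
          (\<forall>u\<in>U. A (glue I1 u y))"
        by (intro exI[of _ "(\<lambda>a. inst \<sigma> (\<lambda>_. a)) ` {..<k}"]) blast
    qed
    then obtain \<sigma> where \<sigma>: "template k {0} I1 \<sigma>"
      and c: "c \<le> mean (cube k I2) (\<lambda>y. of_bool (\<forall>a<k. A (glue I1 (inst \<sigma> (\<lambda>_. a)) y)))"
      unfolding card_cube[OF I1(3)] I1(2) c_def[symmetric] by (fastforce simp: lessThan_def)
    from N2[OF I2 J' c] obtain \<tau> where \<tau>: "template k J' I2 \<tau>"
      "\<And>w a. w \<in> cube k J' \<Longrightarrow> a < k \<Longrightarrow> A (glue I1 (inst \<sigma> (\<lambda>_. a)) (inst \<tau> w))"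
      by blast
    \<comment> \<open>The line on \<open>I1\<close> supplies the wildcard \<open>j\<close>, and
      \<open>\<tau>\<close> supplies the wildcards in \<open>J'\<close> on the other
      coordinates.\<close>
    define \<rho> where "\<rho> i = (if i \<in> I1 then (case \<sigma> i of Inl a \<Rightarrow> Inl a | Inr _ \<Rightarrow> Inr j) else \<tau> i)" for i
    have "template k J I \<rho>"
      unfolding template_def
    proof (intro conjI allI impI ballI)
      fix i a assume a: "\<rho> i = Inl a"
      show "if i \<in> I then a < k else a = 0"
      proof (cases "i \<in> I1")
        case True
        then have "\<sigma> i = Inl a" using a by (auto simp: \<rho>_def split: sum.splits)
        from template_Inl[OF \<sigma> this] True I1 show ?thesis by auto
      next
        case False
        then have "\<tau> i = Inl a" using a by (simp add: \<rho>_def)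
        from template_Inl[OF \<tau>(1) this] False show ?thesis by (auto simp: I2_def)
      qed
    next
      fix i l assume l: "\<rho> i = Inr l"
      have "i \<in> I \<and> l \<in> J"
      proof (cases "i \<in> I1")
        case True
        then show ?thesis using l I1 j by (auto simp: \<rho>_def split: sum.splits)
      next
        case False
        then have "\<tau> i = Inr l" using l by (simp add: \<rho>_def)
        from template_Inr[OF \<tau>(1) this] show ?thesis by (auto simp: I2_def J'_def)
      qed
      then show "i \<in> I" "l \<in> J" by auto
    next
      fix l assume "l \<in> J"
      show "\<exists>i. \<rho> i = Inr l"
      proof (cases "l = j")
        case True
        obtain i where i: "\<sigma> i = Inr 0" using template_ex[OF \<sigma>] by blast
        with template_Inr[OF \<sigma> i] True show ?thesis by (intro exI[of _ i]) (simp add: \<rho>_def)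
      next
        case False
        then have "l \<in> J'" using \<open>l \<in> J\<close> by (simp add: J'_def)
        then obtain i where i: "\<tau> i = Inr l" using template_ex[OF \<tau>(1)] by blast
        with template_Inr[OF \<tau>(1) i] show ?thesis by (intro exI[of _ i]) (simp add: \<rho>_def I2_def)
      qed
    qed
    moreover have "A (inst \<rho> w)" if w: "w \<in> cube k J" for w
    proof -
      define v where "v i = (if i \<in> J' then w i else 0)" for i
      have v: "v \<in> cube k J'" using cube_less[OF w] by (intro cubeI) (auto simp: v_def J'_def)
      have "inst \<rho> w = glue I1 (inst \<sigma> (\<lambda>_. w j)) (inst \<tau> v)"
      proof
        fix i
        show "inst \<rho> w i = glue I1 (inst \<sigma> (\<lambda>_. w j)) (inst \<tau> v) i"
          using template_Inr[OF \<tau>(1), of i] template_Inr[OF \<sigma>, of i]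
          by (auto simp: inst_def glue_def \<rho>_def v_def split: sum.splits)
      qed
      then show ?thesis using \<tau>(2)[OF v cube_less[OF w j]] by simp
    qed
    ultimately show ?thesis by blast
  qed
  show ?case
    unfolding mdhj_def by (intro exI[of _ "N1 + N2"] allI impI) (rule *)
qed

section \<open>Insensitive sets\<close>

definition subst_top :: "nat \<Rightarrow> nat \<Rightarrow> (nat \<Rightarrow> nat) \<Rightarrow> nat \<Rightarrow> nat" where
  "subst_top k c x = (\<lambda>i. if x i = k then c else x i)"

text \<open>For \<open>c < k\<close> this is invariance under exchanging \<open>c\<close> and
  \<open>k\<close> at any positions: words that differ only so have the same image under
  \<open>subst_top\<close>.\<close>

definition insensitive :: "nat \<Rightarrow> nat set \<Rightarrow> nat \<Rightarrow> ((nat \<Rightarrow> nat) \<Rightarrow> bool) \<Rightarrow> bool" where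
  "insensitive k I c E \<longleftrightarrow> (\<forall>x\<in>cube (Suc k) I. E x \<longleftrightarrow> E (subst_top k c x))"

lemma subst_top_in_cube:
  assumes "c < k" "x \<in> cube (Suc k) I"
  shows "subst_top k c x \<in> cube k I"
proof (rule cubeI)
  fix i assume "i \<in> I"
  then show "subst_top k c x i < k"
    using cube_less[OF assms(2), of i] assms(1) by (auto simp: subst_top_def)
qed (use cube_0[OF assms(2)] assms(1) in \<open>simp add: subst_top_def\<close>)

lemma subst_top_in_cube_Suc: "c < k \<Longrightarrow> x \<in> cube (Suc k) I \<Longrightarrow> subst_top k c x \<in> cube (Suc k) I"
  by (rule subsetD[OF cube_mono[OF le_SucI[OF order_refl]] subst_top_in_cube])

text \<open>\<open>subst_top\<close> and \<open>inst\<close> do not commute if the template itself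
  contains the letter \<open>k\<close>; the outer substitution on both sides repairs this.\<close>

lemma subst_top_inst: "c < k \<Longrightarrow> subst_top k c (inst \<tau> (subst_top k c w)) = subst_top k c (inst \<tau> w)"
  by (auto simp: subst_top_def inst_def fun_eq_iff split: sum.splits)

lemma insensitive_inst:
  assumes "template (Suc k) J I \<tau>" "insensitive k I c E" "c < k"
  shows "insensitive k J c (\<lambda>w. E (inst \<tau> w))"
  unfolding insensitive_def
proof
  fix w assume w: "w \<in> cube (Suc k) J"
  have "E (inst \<tau> w) \<longleftrightarrow> E (subst_top k c (inst \<tau> w))"
    using assms(2) inst_in_cube[OF assms(1) w] by (simp add: insensitive_def)
  also have "\<dots> \<longleftrightarrow> E (inst \<tau> (subst_top k c w))"
    using assms(2) inst_in_cube[OF assms(1) subst_top_in_cube_Suc[OF assms(3) w]]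
    by (simp add: insensitive_def subst_top_inst[OF assms(3)])
  finally show "E (inst \<tau> w) \<longleftrightarrow> E (inst \<tau> (subst_top k c w))" .
qed

text \<open>Conditionally on the set \<open>Q\<close> of coordinates carrying the top letter, a uniform word over
  \<open>Suc k\<close> letters is uniform over \<open>k\<close> letters on the remaining coordinates.\<close>

lemma insensitive_contains_subspace:
  assumes k: "c < k" and mdhj: "\<And>b. 0 < b \<Longrightarrow> mdhj k m b" and b: "0 < b"
  obtains N where "\<And>I J E. finite I \<Longrightarrow> N \<le> card I \<Longrightarrow> finite J \<Longrightarrow> card J = m \<Longrightarrow> insensitive k I c E \<Longrightarrow>
     b \<le> mean (cube (Suc k) I) (\<lambda>x. of_bool (E x)) \<Longrightarrow>
     \<exists>\<tau>. template (Suc k) J I \<tau> \<and> (\<forall>w\<in>cube (Suc k) J. E (inst \<tau> w))"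
proof -
  obtain N1 where N1: "\<And>I J A. finite I \<Longrightarrow> N1 \<le> card I \<Longrightarrow> finite J \<Longrightarrow> card J = m \<Longrightarrow>
      b / 2 \<le> mean (cube k I) (\<lambda>x. of_bool (A x)) \<Longrightarrow>
      \<exists>\<tau>. template k J I \<tau> \<and> (\<forall>w\<in>cube k J. A (inst \<tau> w))"
    using mdhj[of "b / 2"] b unfolding mdhj_def by auto
  obtain N where N: "\<And>I. finite I \<Longrightarrow> N \<le> card I \<Longrightarrow>
      mean (cube (Suc k) I) (\<lambda>x. of_bool (card {i \<in> I. x i < k} < N1)) \<le> b / 4"
    using few_occurrences[of c "Suc k" "\<lambda>a. a < k" "b / 4" N1] k b by auto
  have *: "\<exists>\<tau>. template (Suc k) J I \<tau> \<and> (\<forall>w\<in>cube (Suc k) J. E (inst \<tau> w))"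
    if I: "finite I" "N \<le> card I" and J: "finite J" "card J = m" and ins: "insensitive k I c E"
      and E: "b \<le> mean (cube (Suc k) I) (\<lambda>x. of_bool (E x))" for I J E
  proof -
    define Z where "Z = cube (Suc k) I"
    define fib where "fib Q = {z \<in> Z. {i \<in> I. z i = k} = Q}" for Q
    \<comment> \<open>On a fibre with fewer than \<open>N1\<close> free coordinates \<open>g\<close>
      is above 1. So a fibre on which \<open>E\<close> beats \<open>g\<close> has enough free
      coordinates, and \<open>E\<close> has density above \<open>b / 2\<close> there.\<close>
    define g :: "(nat \<Rightarrow> nat) \<Rightarrow> real" where "g z = b / 2 + of_bool (card {i \<in> I. z i < k} < N1)" for z
    have Z: "finite Z" "Z \<noteq> {}" using I by (auto simp: Z_def finite_cube cube_ne)
    have "mean Z g < mean Z (\<lambda>z. of_bool (E z))"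
      using N[OF I] E b Z unfolding g_def by (simp add: mean_add mean_const flip: Z_def)
    then have "sum g Z < (\<Sum>z\<in>Z. of_bool (E z))"
      using Z by (simp add: mean_def divide_less_cancel card_gt_0_iff)
    moreover have "(\<Sum>Q\<in>Pow I. sum f (fib Q)) = sum f Z" for f :: "_ \<Rightarrow> real"
      unfolding fib_def by (rule sum.group) (use Z I in auto)
    ultimately have "(\<Sum>Q\<in>Pow I. sum g (fib Q)) < (\<Sum>Q\<in>Pow I. \<Sum>z\<in>fib Q. of_bool (E z))"
      by simp
    then obtain Q where Q: "Q \<subseteq> I" and sum: "sum g (fib Q) < (\<Sum>z\<in>fib Q. of_bool (E z))"
      by (meson PowD leD not_le_imp_less sum_mono)
    define I' where "I' = I - Q"
    have free: "{i \<in> I. z i < k} = I'" if "z \<in> fib Q" for z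
      using that cube_less[of z "Suc k" I] by (auto simp: fib_def Z_def I'_def less_Suc_eq)
    have N1': "N1 \<le> card I'"
    proof (rule ccontr)
      assume "\<not> N1 \<le> card I'"
      then have "(\<Sum>z\<in>fib Q. of_bool (E z)) \<le> sum g (fib Q)"
        using b by (intro sum_mono) (simp add: g_def free)
      with sum show False by simp
    qed
    define y where "y i = (if i \<in> Q then k else 0)" for i
    have I'_sub: "I' \<subseteq> I" "I - I' = Q" using Q by (auto simp: I'_def)
    have y: "y \<in> cube (Suc k) (I - I')" by (rule cubeI) (simp_all add: y_def I'_sub)
    have "bij_betw (\<lambda>w. glue I' w y) (cube k I') (fib Q)"
    proof (rule bij_betw_byWitness[where f' = "\<lambda>z i. if i \<in> I' then z i else 0"])
      show "\<forall>w\<in>cube k I'. (\<lambda>i. if i \<in> I' then glue I' w y i else 0) = w"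
        using cube_0 by (fastforce simp: glue_def fun_eq_iff)
      show "\<forall>z\<in>fib Q. glue I' (\<lambda>i. if i \<in> I' then z i else 0) y = z"
      proof
        fix z assume z: "z \<in> fib Q"
        have "z i = y i" if "i \<notin> I'" for i
        proof (cases "i \<in> Q")
          case True then show ?thesis using z by (auto simp: fib_def y_def)
        next
          case False then have "i \<notin> I" using that by (auto simp: I'_def)
          then show ?thesis using z cube_0[of z "Suc k" I i] False by (simp add: fib_def y_def Z_def)
        qed
        then show "glue I' (\<lambda>i. if i \<in> I' then z i else 0) y = z"
          by (simp add: glue_def fun_eq_iff)
      qed
      show "(\<lambda>w. glue I' w y) ` cube k I' \<subseteq> fib Q"
      proof clarify
        fix w assume w: "w \<in> cube k I'"
        have "w \<in> cube (Suc k) I'" using w cube_mono[of k "Suc k" I'] by auto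
        then have "glue I' w y \<in> Z" unfolding Z_def by (rule glue_in_cube'[OF I'_sub(1) _ y])
        moreover have "{i \<in> I. glue I' w y i = k} = Q"
          using cube_less[OF w] Q by (auto simp: glue_def y_def I'_def)
        ultimately show "glue I' w y \<in> fib Q" by (simp add: fib_def)
      qed
      show "(\<lambda>z i. if i \<in> I' then z i else 0) ` fib Q \<subseteq> cube k I'"
      proof (clarify, rule cubeI)
        fix z i assume "z \<in> fib Q" "i \<in> I'"
        with free[of z] have "i \<in> {i \<in> I. z i < k}" by simp
        with \<open>i \<in> I'\<close> show "(if i \<in> I' then z i else 0) < k" by simp
      qed simp
    qed
    note reindex = mean_reindex[OF this]
    have "b / 2 \<le> mean (cube k I') (\<lambda>w. of_bool (E (glue I' w y)))"
    proof -
      have fin: "finite (fib Q)" using Z by (simp add: fib_def)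
      have "b / 2 * card (fib Q) \<le> sum g (fib Q)"
      proof -
        have "(\<Sum>z\<in>fib Q. b / 2) \<le> sum g (fib Q)" by (rule sum_mono) (simp add: g_def)
        then show ?thesis by (simp add: mult.commute)
      qed
      moreover have "fib Q \<noteq> {}" using sum by auto
      ultimately have "b / 2 \<le> mean (fib Q) (\<lambda>z. of_bool (E z))"
        unfolding mean_def using sum fin by (subst pos_le_divide_eq) (auto simp: card_gt_0_iff)
      then show ?thesis by (simp only: reindex)
    qed
    from N1[OF finite_subset[OF I'_sub(1) I(1)] N1' J this] obtain \<tau> where
      \<tau>: "template k J I' \<tau>" and E': "\<And>w. w \<in> cube k J \<Longrightarrow> E (glue I' (inst \<tau> w) y)" by blast
    define \<rho> where "\<rho> = tcomp (fill I' y) \<tau>"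
    have \<rho>: "template (Suc k) J I \<rho>"
      unfolding \<rho>_def using template_tcomp[OF template_fill'[OF I'_sub(1) y] template_mono[OF \<tau>]] by simp
    \<comment> \<open>\<open>\<tau>\<close> settles only the words without the letter
      \<open>k\<close>; insensitivity of the pulled-back set settles the others.\<close>
    have "E (inst \<rho> w)" if w: "w \<in> cube (Suc k) J" for w
    proof -
      have "E (inst \<rho> (subst_top k c w))"
        using E'[OF subst_top_in_cube[OF k w]] by (simp add: \<rho>_def inst_tcomp inst_fill)
      then show ?thesis
        using insensitive_inst[OF \<rho> ins k] w by (simp add: insensitive_def)
    qed
    with \<rho> show ?thesis by blast
  qed
  show ?thesis by (rule that) (rule *)
qed

section \<open>Density increments on insensitive sets and their intersections\<close>

lemma mean_cube_split':
  assumes "I1 \<subseteq> I"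
  shows "mean (cube k I) f = mean (cube k I1) (\<lambda>x. mean (cube k (I - I1)) (\<lambda>y. f (glue I1 x y)))"
  by (subst mean_cube_split[OF assms], subst mean_swap) simp

lemma glue_commute:
  assumes "I1 \<subseteq> I" "x \<in> cube k I1" "y \<in> cube k (I - I1)"
  shows "glue I1 x y = glue (I - I1) y x"
proof
  fix i show "glue I1 x y i = glue (I - I1) y x i"
    using cube_0[OF assms(2), of i] cube_0[OF assms(3), of i] assms(1)
    by (cases "i \<in> I1"; cases "i \<in> I") (auto simp: glue_def)
qed

lemma insensitive_glue:
  assumes "insensitive k I c E" "I1 \<subseteq> I" "x \<in> cube (Suc k) I1" "c < k"
  shows "insensitive k (I - I1) c (\<lambda>y. E (glue I1 x y))"
  unfolding insensitive_def
proof
  fix y assume y: "y \<in> cube (Suc k) (I - I1)"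
  have "I - (I - I1) = I1" using assms(2) by blast
  then have "template (Suc k) (I - I1) I (fill (I - I1) x)"
    using template_fill'[of "I - I1" I x "Suc k"] assms(3) by simp
  from insensitive_inst[OF this assms(1,4)]
  have "E (glue (I - I1) y x) \<longleftrightarrow> E (glue (I - I1) (subst_top k c y) x)"
    using y by (simp add: insensitive_def inst_fill)
  then show "E (glue I1 x y) \<longleftrightarrow> E (glue I1 x (subst_top k c y))"
    using glue_commute[OF assms(2,3) y]
      glue_commute[OF assms(2,3) subst_top_in_cube_Suc[OF assms(4) y]] by simp
qed

lemma mean_inst_image:
  assumes "template k J I \<sigma>" "finite J"
  shows "mean (cube k I) (\<lambda>x. f x * of_bool (x \<in> inst \<sigma> ` cube k J))
       = card (cube k J) / card (cube k I) * mean (cube k J) (\<lambda>w. f (inst \<sigma> w))"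
proof (cases "finite (cube k I)")
  case True
  have sub: "inst \<sigma> ` cube k J \<subseteq> cube k I" using inst_in_cube[OF assms(1)] by blast
  have "(\<Sum>x\<in>cube k I. f x * of_bool (x \<in> inst \<sigma> ` cube k J))
      = (\<Sum>x\<in>inst \<sigma> ` cube k J. f x * of_bool (x \<in> inst \<sigma> ` cube k J))"
    by (rule sum.mono_neutral_right[OF True sub]) auto
  also have "\<dots> = (\<Sum>x\<in>inst \<sigma> ` cube k J. f x)" by (rule sum.cong) auto
  also have "\<dots> = (\<Sum>w\<in>cube k J. f (inst \<sigma> w))"
    using sum.reindex[OF inj_on_inst[OF assms(1)], of f] by (simp add: o_def)
  finally have "mean (cube k I) (\<lambda>x. f x * of_bool (x \<in> inst \<sigma> ` cube k J))
      = (\<Sum>w\<in>cube k J. f (inst \<sigma> w)) / card (cube k I)"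
    unfolding mean_def by simp
  moreover have "cube k J = {} \<or> card (cube k J) \<noteq> 0"
    using finite_cube[OF assms(2), of k] by simp
  ultimately show ?thesis by (auto simp: mean_def)
qed (simp add: mean_def)

text \<open>A function that has nonpositive mean on all \<open>m\<close>-dimensional subspaces inside \<open>E\<close> has small
  mean on \<open>E\<close>: as long as \<open>E\<close> is dense, a product \<open>U \<times> B\<close> of a subspace \<open>U\<close> and a dense
  insensitive set \<open>B\<close> can be split off, and what is left on every fibre is insensitive again.\<close>

lemma mean_on_insensitive_le:
  assumes k: "c < k" and b: "0 < b" "b \<le> 1"
    and sub: "\<And>I J E. finite I \<Longrightarrow> p \<le> card I \<Longrightarrow> finite J \<Longrightarrow> card J = m \<Longrightarrow> insensitive k I c E \<Longrightarrow>
       b / 2 \<le> mean (cube (Suc k) I) (\<lambda>x. of_bool (E x)) \<Longrightarrow>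
       \<exists>\<tau>. template (Suc k) J I \<tau> \<and> (\<forall>w\<in>cube (Suc k) J. E (inst \<tau> w))"
    and d: "d = b / 2 / 2 ^ (Suc k ^ p) / Suc k ^ p"
    and J: "finite J" "card J = m"
    and I: "finite I" "t * p \<le> card I"
    and E: "insensitive k I c E"
    and g: "\<And>x. g x \<le> 1"
    and nonpos: "\<And>\<tau>. template (Suc k) J I \<tau> \<Longrightarrow> \<forall>w\<in>cube (Suc k) J. E (inst \<tau> w) \<Longrightarrow>
       mean (cube (Suc k) J) (\<lambda>w. g (inst \<tau> w)) \<le> 0"
  shows "mean (cube (Suc k) I) (\<lambda>x. g x * of_bool (E x))
       \<le> b + (1 - d) ^ t * mean (cube (Suc k) I) (\<lambda>x. of_bool (E x))"
  using I E g nonpos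
proof (induction t arbitrary: I E g)
  case 0
  have "mean (cube (Suc k) I) (\<lambda>x. g x * of_bool (E x)) \<le> mean (cube (Suc k) I) (\<lambda>x. of_bool (E x))"
    using 0 by (intro mean_mono) simp
  then show ?case using b by simp
next
  case (Suc t)
  have d01: "0 < d" "d \<le> 1"
  proof -
    show "0 < d" using b by (simp add: d)
    have "b / 2 \<le> 1 * 1" using b by simp
    also have "\<dots> \<le> 2 ^ (Suc k ^ p) * real (Suc k ^ p)"
      by (intro mult_mono) (simp_all add: Suc_leI del: power_Suc of_nat_power)
    finally show "d \<le> 1" by (simp add: d field_simps)
  qed
  define e where "e = mean (cube (Suc k) I) (\<lambda>x. of_bool (E x))"
  have e1: "0 \<le> e" "e \<le> 1" by (simp_all add: e_def mean_of_bool_le_1 mean_nonneg)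
  show ?case
  \<comment> \<open>A sparse \<open>E\<close> is covered by the term \<open>b\<close>; for a dense
    one, \<open>p\<close> coordinates are used up to split off a piece.\<close>
  proof (cases "b \<le> e")
    case False
    have "mean (cube (Suc k) I) (\<lambda>x. g x * of_bool (E x)) \<le> e"
      unfolding e_def using Suc.prems(4) by (intro mean_mono) simp
    also have "\<dots> \<le> b + 0" using False by simp
    also have "\<dots> \<le> b + (1 - d) ^ Suc t * e"
      using d01 e1 by (intro add_left_mono mult_nonneg_nonneg) simp_all
    finally show ?thesis by (simp add: e_def)
  next
    case True
    obtain I1 where I1: "I1 \<subseteq> I" "card I1 = p" "finite I1"
      using obtain_subset_with_card_n[of p I] Suc.prems(1,2)
      by (metis add_leD1 mult_Suc)
    define I2 where "I2 = I - I1"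
    have I2: "finite I2" "t * p \<le> card I2"
      using Suc.prems(1,2) I1 by (auto simp: I2_def card_Diff_subset)
    define X where "X = cube (Suc k) I1"
    define Y where "Y = cube (Suc k) I2"
    have X: "finite X" "X \<noteq> {}" and Y: "finite Y" "Y \<noteq> {}"
      using I1 I2 by (simp_all add: X_def Y_def finite_cube cube_ne)
    have card_X: "card X = Suc k ^ p" by (simp add: X_def card_cube[OF I1(3)] I1(2))
    have split: "mean (cube (Suc k) I) f = mean X (\<lambda>x. mean Y (\<lambda>y. f (glue I1 x y)))" for f
      unfolding X_def Y_def I2_def by (rule mean_cube_split'[OF I1(1)])
    have in_glue: "E (glue I1 x y) \<longleftrightarrow> E (glue I1 x (subst_top k c y))" if "x \<in> X" "y \<in> Y" for x y
      using insensitive_glue[OF Suc.prems(3) I1(1) _ k] that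
      by (simp add: insensitive_def X_def Y_def I2_def)
    have "\<exists>U\<subseteq>X. (\<exists>\<sigma>. template (Suc k) J I1 \<sigma> \<and> U = inst \<sigma> ` cube (Suc k) J) \<and>
       b / 2 / 2 ^ card X \<le> mean Y (\<lambda>y. of_bool (\<forall>u\<in>U. E (glue I1 u y)))"
    proof (rule popular_subset[OF X Y b(1)])
      have "e = mean Y (\<lambda>y. mean X (\<lambda>x. of_bool (E (glue I1 x y))))"
        unfolding e_def split by (rule mean_swap)
      then show "b \<le> mean Y (\<lambda>y. mean X (\<lambda>x. of_bool (E (glue I1 x y))))" using True by simp
      fix y assume y: "y \<in> Y" and dens: "b / 2 \<le> mean X (\<lambda>x. of_bool (E (glue I1 x y)))"
      have y': "template (Suc k) I1 I (fill I1 y)"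
        using y template_fill'[OF I1(1)] by (simp add: Y_def I2_def)
      have "insensitive k I1 c (\<lambda>x. E (glue I1 x y))"
        using insensitive_inst[OF y' Suc.prems(3) k] by (simp add: inst_fill)
      from sub[OF I1(3) _ J this dens[unfolded X_def]] I1(2) obtain \<sigma>
        where \<sigma>: "template (Suc k) J I1 \<sigma>" "\<forall>w\<in>cube (Suc k) J. E (glue I1 (inst \<sigma> w) y)" by auto
      then show "\<exists>U\<subseteq>X. (\<exists>\<sigma>. template (Suc k) J I1 \<sigma> \<and> U = inst \<sigma> ` cube (Suc k) J) \<and>
          (\<forall>u\<in>U. E (glue I1 u y))"
        using inst_in_cube[OF \<sigma>(1)]
        by (intro exI[of _ "inst \<sigma> ` cube (Suc k) J"]) (auto simp: X_def)
    qed
    then obtain U \<sigma> where U: "U \<subseteq> X" "U = inst \<sigma> ` cube (Suc k) J" and \<sigma>: "template (Suc k) J I1 \<sigma>"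
      and dens: "b / 2 / 2 ^ (Suc k ^ p) \<le> mean Y (\<lambda>y. of_bool (\<forall>u\<in>U. E (glue I1 u y)))"
      unfolding card_X by blast
    define B where "B y \<longleftrightarrow> (\<forall>u\<in>U. E (glue I1 u y))" for y
    define E' where "E' x y \<longleftrightarrow> E (glue I1 x y) \<and> \<not> (x \<in> U \<and> B y)" for x y
    have UB: "x \<in> U \<and> B y \<Longrightarrow> E (glue I1 x y)" for x y by (auto simp: B_def)
    have part1: "mean X (\<lambda>x. mean Y (\<lambda>y. g (glue I1 x y) * of_bool (x \<in> U \<and> B y))) \<le> 0"
    proof -
      have "mean Y (\<lambda>y. mean X (\<lambda>x. g (glue I1 x y) * of_bool (x \<in> U \<and> B y))) \<le> mean Y (\<lambda>_. 0)"
      proof (rule mean_mono)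
        fix y assume y: "y \<in> Y"
        show "mean X (\<lambda>x. g (glue I1 x y) * of_bool (x \<in> U \<and> B y)) \<le> 0"
        proof (cases "B y")
          case True
          have y': "template (Suc k) I1 I (fill I1 y)"
            using y template_fill'[OF I1(1)] by (simp add: Y_def I2_def)
          have "mean (cube (Suc k) J) (\<lambda>w. g (inst (tcomp (fill I1 y) \<sigma>) w)) \<le> 0"
            by (rule Suc.prems(5)[OF template_tcomp[OF y' \<sigma>]])
               (use True U in \<open>simp add: inst_tcomp inst_fill B_def\<close>)
          then have "mean X (\<lambda>x. g (glue I1 x y) * of_bool (x \<in> U)) \<le> 0"
            unfolding X_def U(2) mean_inst_image[OF \<sigma> J(1)]
            by (simp add: inst_tcomp inst_fill mult_nonneg_nonpos divide_nonpos_nonneg)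
          then show ?thesis using True by simp
        qed (simp add: mean_const X)
      qed
      then show ?thesis using Y by (subst mean_swap) (simp add: mean_const)
    qed
    \<comment> \<open>Origin of \<open>d\<close>: \<open>U\<close> has at least one of the
      \<open>Suc k ^ p\<close> words of \<open>X\<close>, and \<open>B\<close> has the density given
      by \<open>popular_subset\<close>.\<close>
    have mean_UB: "d \<le> mean X (\<lambda>x. mean Y (\<lambda>y. of_bool (x \<in> U \<and> B y)))"
    proof -
      have "mean X (\<lambda>x. mean Y (\<lambda>y. of_bool (x \<in> U \<and> B y)))
          = mean X (\<lambda>x. of_bool (x \<in> U) * mean Y (\<lambda>y. of_bool (B y)))"
        by (rule mean_cong) (simp add: of_bool_conj mean_cmult)
      also have "\<dots> = mean X (\<lambda>x. of_bool (x \<in> U)) * mean Y (\<lambda>y. of_bool (B y))"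
        by (rule mean_multc)
      finally have *: "mean X (\<lambda>x. mean Y (\<lambda>y. of_bool (x \<in> U \<and> B y)))
          = mean X (\<lambda>x. of_bool (x \<in> U)) * mean Y (\<lambda>y. of_bool (B y))" .
      have "U \<noteq> {}" using cube_ne[of "Suc k" J] U(2) by simp
      then obtain u where u: "u \<in> U" by blast
      have "(\<Sum>x\<in>{u}. of_bool (x \<in> U)) \<le> (\<Sum>x\<in>X. of_bool (x \<in> U) :: real)"
        by (rule sum_mono2) (use X u U(1) in auto)
      then have "1 / Suc k ^ p \<le> mean X (\<lambda>x. of_bool (x \<in> U))"
        unfolding mean_def card_X using u by (simp add: divide_right_mono)
      then have "1 / Suc k ^ p * (b / 2 / 2 ^ (Suc k ^ p))
          \<le> mean X (\<lambda>x. of_bool (x \<in> U)) * mean Y (\<lambda>y. of_bool (B y))"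
        using dens b unfolding B_def by (intro mult_mono) (auto intro!: mean_nonneg)
      then show ?thesis unfolding * d by (simp add: mult.commute)
    qed
    \<comment> \<open>The fibres are taken over \<open>x\<close>, not over \<open>y\<close>: for
      fixed \<open>x\<close> the removed part is empty or \<open>B\<close>, which is insensitive,
      while \<open>U\<close> need not be.\<close>
    have part2: "mean Y (\<lambda>y. g (glue I1 x y) * of_bool (E' x y))
        \<le> b + (1 - d) ^ t * mean Y (\<lambda>y. of_bool (E' x y))" if x: "x \<in> X" for x
      unfolding Y_def
    proof (rule Suc.IH[OF I2])
      show "insensitive k I2 c (E' x)"
        unfolding insensitive_def
      proof
        fix y assume "y \<in> cube (Suc k) I2"
        then show "E' x y \<longleftrightarrow> E' x (subst_top k c y)"
          using in_glue[of _ y] x U(1) unfolding E'_def B_def Y_def by blast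
      qed
      show "g (glue I1 x y) \<le> 1" for y by (rule Suc.prems(4))
      fix \<tau> assume \<tau>: "template (Suc k) J I2 \<tau>" and in_E': "\<forall>w\<in>cube (Suc k) J. E' x (inst \<tau> w)"
      have "I - I2 = I1" using I1(1) by (auto simp: I2_def)
      then have x': "template (Suc k) I2 I (fill I2 x)"
        using template_fill'[of I2 I x "Suc k"] x by (simp add: X_def I2_def)
      have eq: "inst (tcomp (fill I2 x) \<tau>) w = glue I1 x (inst \<tau> w)" if "w \<in> cube (Suc k) J" for w
        using glue_commute[OF I1(1), of x "Suc k" "inst \<tau> w"] inst_in_cube[OF \<tau> that] x
        by (simp add: inst_tcomp inst_fill I2_def X_def)
      have "mean (cube (Suc k) J) (\<lambda>w. g (inst (tcomp (fill I2 x) \<tau>) w)) \<le> 0"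
        by (rule Suc.prems(5)[OF template_tcomp[OF x' \<tau>]]) (use in_E' in \<open>simp add: eq E'_def\<close>)
      also have "mean (cube (Suc k) J) (\<lambda>w. g (inst (tcomp (fill I2 x) \<tau>) w))
          = mean (cube (Suc k) J) (\<lambda>w. g (glue I1 x (inst \<tau> w)))"
        by (rule mean_cong) (simp add: eq)
      finally show "mean (cube (Suc k) J) (\<lambda>w. g (glue I1 x (inst \<tau> w))) \<le> 0" .
    qed
    have "mean (cube (Suc k) I) (\<lambda>x. g x * of_bool (E x))
        = mean X (\<lambda>x. mean Y (\<lambda>y. g (glue I1 x y) * of_bool (x \<in> U \<and> B y)
            + g (glue I1 x y) * of_bool (E' x y)))"
      unfolding split
    proof (intro mean_cong)
      fix x y show "g (glue I1 x y) * of_bool (E (glue I1 x y))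
          = g (glue I1 x y) * of_bool (x \<in> U \<and> B y) + g (glue I1 x y) * of_bool (E' x y)"
        using UB[of x y] by (cases "x \<in> U \<and> B y") (auto simp: E'_def)
    qed
    also have "\<dots> \<le> 0 + mean X (\<lambda>x. mean Y (\<lambda>y. g (glue I1 x y) * of_bool (E' x y)))"
      unfolding mean_add using part1 by simp
    \<comment> \<open>The bound is affine in the density of the set, so it survives averaging over
      \<open>x\<close>.\<close>
    also have "\<dots> \<le> mean X (\<lambda>x. b + (1 - d) ^ t * mean Y (\<lambda>y. of_bool (E' x y)))"
      using part2 by (simp add: mean_mono)
    also have "\<dots> = b + (1 - d) ^ t * mean X (\<lambda>x. mean Y (\<lambda>y. of_bool (E' x y)))"
      by (simp add: mean_add mean_cmult mean_const X)
    also have "mean X (\<lambda>x. mean Y (\<lambda>y. of_bool (E' x y)))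
        = e - mean X (\<lambda>x. mean Y (\<lambda>y. of_bool (x \<in> U \<and> B y)))"
      unfolding e_def split mean_diff[symmetric]
    proof (intro mean_cong)
      fix x y show "(of_bool (E' x y) :: real) = of_bool (E (glue I1 x y)) - of_bool (x \<in> U \<and> B y)"
        using UB[of x y] by (cases "x \<in> U \<and> B y") (auto simp: E'_def)
    qed
    also have "b + (1 - d) ^ t * (e - mean X (\<lambda>x. mean Y (\<lambda>y. of_bool (x \<in> U \<and> B y))))
        \<le> b + (1 - d) ^ t * ((1 - d) * e)"
    proof (intro add_left_mono mult_left_mono)
      have "e - mean X (\<lambda>x. mean Y (\<lambda>y. of_bool (x \<in> U \<and> B y))) \<le> e - d * 1"
        using mean_UB by simp
      also have "\<dots> \<le> e - d * e" using e1 d01 by (intro diff_left_mono mult_left_mono) auto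
      finally show "e - mean X (\<lambda>x. mean Y (\<lambda>y. of_bool (x \<in> U \<and> B y))) \<le> (1 - d) * e"
        by (simp add: algebra_simps)
    qed (use d01 in simp)
    finally show ?thesis by (simp add: e_def mult.assoc mult.left_commute)
  qed
qed

text \<open>Contrapositive of \<open>mean_on_insensitive_le\<close>, with \<open>t\<close> so large
  that its bound drops below \<open>b\<close>. In the application \<open>g\<close> is an indicator
  minus a threshold, so a positive mean on a subspace is a density increment.\<close>

lemma insensitive_increment:
  assumes k: "c < k" and mdhj: "\<And>b. 0 < b \<Longrightarrow> mdhj k m b" and b: "0 < b"
  obtains N where "\<And>I J g E. finite I \<Longrightarrow> N \<le> card I \<Longrightarrow> finite J \<Longrightarrow> card J = m \<Longrightarrow> insensitive k I c E \<Longrightarrow>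
     (\<And>x. g x \<le> 1) \<Longrightarrow> b \<le> mean (cube (Suc k) I) (\<lambda>x. g x * of_bool (E x)) \<Longrightarrow>
     \<exists>\<tau>. template (Suc k) J I \<tau> \<and> (\<forall>w\<in>cube (Suc k) J. E (inst \<tau> w)) \<and>
        0 < mean (cube (Suc k) J) (\<lambda>w. g (inst \<tau> w))"
proof -
  define b' where "b' = min (b / 3) 1"
  have b': "0 < b'" "b' \<le> 1" "b' \<le> b / 3" using b by (auto simp: b'_def)
  obtain p where p: "\<And>I J E. finite I \<Longrightarrow> p \<le> card I \<Longrightarrow> finite J \<Longrightarrow> card J = m \<Longrightarrow> insensitive k I c E \<Longrightarrow>
       b' / 2 \<le> mean (cube (Suc k) I) (\<lambda>x. of_bool (E x)) \<Longrightarrow>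
       \<exists>\<tau>. template (Suc k) J I \<tau> \<and> (\<forall>w\<in>cube (Suc k) J. E (inst \<tau> w))"
  proof (rule insensitive_contains_subspace[OF k mdhj half_gt_zero[OF b'(1)]], goal_cases)
    case (2 N)
    show ?case by (rule that) (rule 2)
  qed
  define d where "d = b' / 2 / 2 ^ (Suc k ^ p) / Suc k ^ p"
  have "0 < d" using b' by (simp add: d_def)
  then obtain t where t: "(1 - d) ^ t < b / 3"
    using real_arch_pow_inv[of "b / 3" "1 - d"] b by auto
  have *: "\<exists>\<tau>. template (Suc k) J I \<tau> \<and> (\<forall>w\<in>cube (Suc k) J. E (inst \<tau> w)) \<and>
        0 < mean (cube (Suc k) J) (\<lambda>w. g (inst \<tau> w))"
    if I: "finite I" "t * p \<le> card I" and J: "finite J" "card J = m" and E: "insensitive k I c E"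
      and g: "\<And>x. g x \<le> 1" and dens: "b \<le> mean (cube (Suc k) I) (\<lambda>x. g x * of_bool (E x))" for I J g E
  proof (rule ccontr)
    assume "\<not> ?thesis"
    then have *: "mean (cube (Suc k) J) (\<lambda>w. g (inst \<tau> w)) \<le> 0"
      if "template (Suc k) J I \<tau>" "\<forall>w\<in>cube (Suc k) J. E (inst \<tau> w)" for \<tau>
      using that by (meson not_less)
    define e where "e = mean (cube (Suc k) I) (\<lambda>x. of_bool (E x))"
    have e: "0 \<le> e" "e \<le> 1" by (simp_all add: e_def mean_of_bool_le_1 mean_nonneg)
    have "mean (cube (Suc k) I) (\<lambda>x. g x * of_bool (E x)) \<le> b' + (1 - d) ^ t * e"
      unfolding e_def
      by (rule mean_on_insensitive_le[OF k b'(1,2) p d_def J I E g *])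
    also have "\<dots> \<le> b / 3 + b / 3 * 1"
      using t b' b e by (intro add_mono mult_mono) auto
    finally show False using dens b by simp
  qed
  show ?thesis by (rule that) (rule *)
qed

text \<open>Induction on the number of sets: one factor at a time is traded for passing to a
  subspace, large enough for the remaining factors, which stay insensitive on it.\<close>

lemma insensitive_inter_increment:
  assumes j: "j \<le> k" "0 < k" and mdhj: "\<And>m b. 0 < b \<Longrightarrow> mdhj k m b" and b: "0 < b"
  obtains N where "\<And>I J g E. finite I \<Longrightarrow> N \<le> card I \<Longrightarrow> finite J \<Longrightarrow> card J = m \<Longrightarrow>
     (\<And>c. c < j \<Longrightarrow> insensitive k I c (E c)) \<Longrightarrow>
     (\<And>x. g x \<le> 1) \<Longrightarrow> b \<le> mean (cube (Suc k) I) (\<lambda>x. g x * of_bool (\<forall>c<j. E c x)) \<Longrightarrow>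
     \<exists>\<tau>. template (Suc k) J I \<tau> \<and> 0 < mean (cube (Suc k) J) (\<lambda>w. g (inst \<tau> w))"
  using j b
proof (induction j arbitrary: m b thesis)
  case 0
  obtain N where N: "\<And>I J g E. finite I \<Longrightarrow> N \<le> card I \<Longrightarrow> finite J \<Longrightarrow> card J = m \<Longrightarrow> insensitive k I 0 E \<Longrightarrow>
     (\<And>x. g x \<le> 1) \<Longrightarrow> b \<le> mean (cube (Suc k) I) (\<lambda>x. g x * of_bool (E x)) \<Longrightarrow>
     (\<exists>\<tau>. template (Suc k) J I \<tau> \<and> (\<forall>w\<in>cube (Suc k) J. E (inst \<tau> w)) \<and>
        0 < mean (cube (Suc k) J) (\<lambda>w. g (inst \<tau> w)))"
  proof (rule insensitive_increment[OF 0(3) mdhj 0(4), where m = m], goal_cases)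
    case (2 N)
    show ?case by (rule that) (rule 2)
  qed
  show ?case
  proof (rule 0(1))
    fix I J :: "nat set" and g and E :: "nat \<Rightarrow> (nat \<Rightarrow> nat) \<Rightarrow> bool"
    assume "finite I" "N \<le> card I" "finite J" "card J = m" "\<And>x. g x \<le> 1"
      "b \<le> mean (cube (Suc k) I) (\<lambda>x. g x * of_bool (\<forall>c<0. E c x))"
    then show "\<exists>\<tau>. template (Suc k) J I \<tau> \<and> 0 < mean (cube (Suc k) J) (\<lambda>w. g (inst \<tau> w))"
      using N[of I J "\<lambda>_. True" g] by (auto simp: insensitive_def)
  qed
next
  case (Suc j)
  have jk: "j < k" "j \<le> k" using Suc.prems(2) by auto
  have b2: "0 < b / 2" using Suc.prems(4) by simp
  obtain N1 where N1: "\<And>I J g E. finite I \<Longrightarrow> N1 \<le> card I \<Longrightarrow> finite J \<Longrightarrow> card J = m \<Longrightarrow>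
     (\<And>c. c < j \<Longrightarrow> insensitive k I c (E c)) \<Longrightarrow>
     (\<And>x. g x \<le> 1) \<Longrightarrow> b / 2 \<le> mean (cube (Suc k) I) (\<lambda>x. g x * of_bool (\<forall>c<j. E c x)) \<Longrightarrow>
     (\<exists>\<tau>. template (Suc k) J I \<tau> \<and> 0 < mean (cube (Suc k) J) (\<lambda>w. g (inst \<tau> w)))"
  proof (rule Suc.IH[OF _ jk(2) Suc.prems(3) b2, of m], goal_cases)
    case (1 N)
    show ?case by (rule that) (rule 1)
  qed
  obtain N where N: "\<And>I J g E. finite I \<Longrightarrow> N \<le> card I \<Longrightarrow> finite J \<Longrightarrow> card J = N1 \<Longrightarrow> insensitive k I j E \<Longrightarrow>
     (\<And>x. g x \<le> 1) \<Longrightarrow> b / 2 \<le> mean (cube (Suc k) I) (\<lambda>x. g x * of_bool (E x)) \<Longrightarrow>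
     (\<exists>\<tau>. template (Suc k) J I \<tau> \<and> (\<forall>w\<in>cube (Suc k) J. E (inst \<tau> w)) \<and>
        0 < mean (cube (Suc k) J) (\<lambda>w. g (inst \<tau> w)))"
  proof (rule insensitive_increment[OF jk(1) mdhj b2, where m = N1], goal_cases)
    case (2 N)
    show ?case by (rule that) (rule 2)
  qed
  have *: "\<exists>\<tau>. template (Suc k) J I \<tau> \<and> 0 < mean (cube (Suc k) J) (\<lambda>w. g (inst \<tau> w))"
    if I: "finite I" "N \<le> card I" and J: "finite J" "card J = m"
      and E: "\<And>c. c < Suc j \<Longrightarrow> insensitive k I c (E c)" and g: "\<And>x. g x \<le> 1"
      and dens: "b \<le> mean (cube (Suc k) I) (\<lambda>x. g x * of_bool (\<forall>c<Suc j. E c x))"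
    for I J g and E :: "nat \<Rightarrow> _"
  proof -
    \<comment> \<open>The shift turns a positive mean of \<open>g'\<close> on the subspace into a
      mean above \<open>b / 2\<close> of the remaining product, as the induction hypothesis
      requires.\<close>
    define g' where "g' x = g x * of_bool (\<forall>c<j. E c x) - b / 2" for x
    have g': "g' x \<le> 1" for x
      using g[of x] b2 by (cases "\<forall>c<j. E c x") (simp_all add: g'_def)
    have "b - b / 2 \<le> mean (cube (Suc k) I) (\<lambda>x. g x * of_bool (\<forall>c<Suc j. E c x)) - mean (cube (Suc k) I) (\<lambda>_. b / 2)"
      using dens I by (intro diff_mono) (simp_all add: mean_const finite_cube cube_ne)
    also have "\<dots> \<le> mean (cube (Suc k) I) (\<lambda>x. g' x * of_bool (E j x))"
      unfolding mean_diff[symmetric] g'_def using b2 by (intro mean_mono) (auto simp: less_Suc_eq)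
    finally have dens': "b / 2 \<le> mean (cube (Suc k) I) (\<lambda>x. g' x * of_bool (E j x))" by simp
    have "insensitive k I j (E j)" using E by simp
    from N[OF I _ _ this g' dens', of "{..<N1}"] obtain \<tau> where
      \<tau>: "template (Suc k) {..<N1} I \<tau>"
      and pos: "0 < mean (cube (Suc k) {..<N1}) (\<lambda>w. g' (inst \<tau> w))" by auto
    have "b / 2 \<le> mean (cube (Suc k) {..<N1}) (\<lambda>w. g (inst \<tau> w) * of_bool (\<forall>c<j. E c (inst \<tau> w)))"
      using pos unfolding g'_def by (simp add: mean_diff mean_const finite_cube cube_ne)
    moreover have "insensitive k {..<N1} c (\<lambda>w. E c (inst \<tau> w))" if "c < j" for c
      using E[of c] jk that by (intro insensitive_inst[OF \<tau>]) auto
    ultimately obtain \<sigma> where \<sigma>: "template (Suc k) J {..<N1} \<sigma>"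
      "0 < mean (cube (Suc k) J) (\<lambda>w. g (inst \<tau> (inst \<sigma> w)))"
      using N1[of "{..<N1}" J "\<lambda>c w. E c (inst \<tau> w)" "\<lambda>w. g (inst \<tau> w)"] J g by auto
    then show ?thesis
      using template_tcomp[OF \<tau> \<sigma>(1)] by (intro exI[of _ "tcomp \<tau> \<sigma>"]) (simp add: inst_tcomp)
  qed
  show ?case by (rule Suc.prems(1)) (rule *)
qed

section \<open>The density Hales--Jewett theorem\<close>

text \<open>In \<open>dhj_Suc\<close> a line in \<open>m0\<close> coordinates is spread over blocks
  of size \<open>s\<close>, so that its wildcard occupies at least \<open>s\<close>
  coordinates.\<close>

lemma partition_into_blocks:
  assumes "finite I" "card I = m * s"
  shows "\<exists>h. (\<forall>i\<in>I. h i < m) \<and> (\<forall>j<m. card {i \<in> I. h i = j} = s)"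
  using assms
proof (induction m arbitrary: I)
  case 0
  then show ?case by simp
next
  case (Suc m)
  then obtain S where S: "S \<subseteq> I" "card S = s" "finite S"
    using obtain_subset_with_card_n[of s I] by (metis le_add1 mult_Suc)
  have "finite (I - S)" "card (I - S) = m * s"
    using Suc.prems S by (simp_all add: card_Diff_subset)
  from Suc.IH[OF this] obtain h where h: "\<And>i. i \<in> I - S \<Longrightarrow> h i < m"
    "\<And>j. j < m \<Longrightarrow> card {i \<in> I - S. h i = j} = s" by blast
  define h' where "h' i = (if i \<in> S then m else h i)" for i
  have "{i \<in> I. h' i = m} = S"
    using S(1) h(1) by (auto simp: h'_def split: if_splits)
  moreover have "{i \<in> I. h' i = j} = {i \<in> I - S. h i = j}" if "j < m" for j
    using that by (auto simp: h'_def)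
  moreover have "h' i < Suc m" if "i \<in> I" for i
    using that h(1)[of i] by (auto simp: h'_def)
  ultimately show ?case
    using h(2) S(2) by (intro exI[of _ h']) (simp add: less_Suc_eq)
qed

text \<open>Classifies the points outside an intersection by the first condition that fails. As
  insensitivity passes to complements, each class is again an intersection of insensitive
  sets.\<close>

lemma sum_first_failure:
  fixes k :: nat
  shows "(\<Sum>i<k. of_bool ((\<forall>c<i. P c) \<and> \<not> P i)) = (of_bool (\<not> (\<forall>c<k. P c)) :: real)"
proof (induction k)
  case (Suc k)
  then show ?case by (cases "\<forall>c<k. P c") (auto simp: less_Suc_eq)
qed simp

text \<open>The other values cannot make up for a small \<open>f x\<close>, since each exceeds
  \<open>a\<close> by at most \<open>e\<close>.\<close>

lemma mean_all_large:
  fixes f :: "'a \<Rightarrow> real" and a e :: real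
  assumes S: "finite S" "x \<in> S" and upper: "\<And>y. y \<in> S \<Longrightarrow> f y \<le> a + e" and avg: "a - e \<le> mean S f"
    and e: "0 \<le> e"
  shows "a - 2 * card S * e \<le> f x"
proof -
  have "(a - e) * card S \<le> sum f S"
  proof -
    have "0 < real (card S)" using S by (auto simp: card_gt_0_iff)
    then show ?thesis using avg by (simp add: mean_def pos_le_divide_eq)
  qed
  also have "\<dots> = f x + sum f (S - {x})" using S by (simp add: sum.remove)
  also have "\<dots> \<le> f x + (\<Sum>y\<in>S - {x}. a + e)" using upper by (intro add_left_mono sum_mono) auto
  also have "\<dots> = f x + (card S - 1) * (a + e)"
    using S by (simp add: card_Diff_singleton)
  also have "real (card S - 1) = real (card S) - 1"
    using S card_gt_0_iff[of S] by (cases "card S") auto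
  finally show ?thesis using e by (simp add: algebra_simps)
qed

text \<open>Vacuous, as densities are at most 1. It makes the set whose infimum is the critical
  density nonempty.\<close>

lemma dhj_2: "dhj k 2"
proof -
  have "\<not> 2 \<le> mean S (\<lambda>x. of_bool (P x))" for S :: "(nat \<Rightarrow> nat) set" and P
    using mean_of_bool_le_1[of S P] by linarith
  then show ?thesis by (simp add: dhj_def)
qed

lemma dhj_mono: "dhj k b \<Longrightarrow> b \<le> b' \<Longrightarrow> dhj k b'"
  unfolding dhj_def by (meson order_trans)

text \<open>Let \<open>a\<close> be the critical density for \<open>Suc k\<close> letters. For a line-free set \<open>A\<close> of density almost
  \<open>a\<close> in a huge cube every section over few coordinates has density close to \<open>a\<close>, and no large subspace
  has density exceeding \<open>a\<close> by much. Applying the theorem for \<open>k\<close> letters to a random subspace, whose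
  wildcards are placed at the positions of the top letter in a random word \<open>z\<close>, block by block, yields
  a dense intersection \<open>D\<close> of \<open>k\<close> insensitive sets. It almost misses \<open>A\<close>, because a word in both and
  containing the top letter completes a line. Hence \<open>A\<close> is too dense on the complement of \<open>D\<close>, which is
  a disjoint union of intersections of insensitive sets, and so on a large subspace.\<close>

lemma dhj_Suc:
  assumes k: "0 < k" and dhj: "\<And>b. 0 < b \<Longrightarrow> dhj k b" and b0: "0 < b0"
  shows "dhj (Suc k) b0"
proof (rule ccontr)
  assume contra: "\<not> dhj (Suc k) b0"
  define S where "S = {b. dhj (Suc k) b}"
  define a where "a = Inf S"
  have lower: "b0 \<le> b" if "b \<in> S" for b
    using that contra dhj_mono[of "Suc k" b b0] by (force simp: S_def)
  then have bdd: "bdd_below S" by (rule bdd_belowI)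
  have "2 \<in> S" by (simp add: S_def dhj_2)
  then have a: "b0 \<le> a" "a \<le> 2"
    unfolding a_def using lower bdd by (auto intro: cInf_greatest cInf_lower)
  then have a0: "0 < a" using b0 by simp
  have above: "dhj (Suc k) (a + e)" if "0 < e" for e
  proof -
    have "Inf S < a + e" using that by (simp add: a_def)
    then obtain b where "b \<in> S" "b < a + e" using cInf_lessD[of S "a + e"] \<open>2 \<in> S\<close> by blast
    then show ?thesis using dhj_mono by (auto simp: S_def)
  qed
  have below: "\<not> dhj (Suc k) (a - e)" if "0 < e" for e
  proof
    assume "dhj (Suc k) (a - e)"
    then have "Inf S \<le> a - e" using bdd by (intro cInf_lower) (simp_all add: S_def)
    then have "a \<le> a - e" by (simp add: a_def)
    then show False using that by simp
  qed

  obtain m0 where m0: "\<And>I A. finite I \<Longrightarrow> m0 \<le> card I \<Longrightarrow>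
      a / 2 / 2 \<le> mean (cube k I) (\<lambda>x. of_bool (A x)) \<Longrightarrow> has_line k I A"
    using dhj[of "a / 2 / 2"] a0 by (auto simp: dhj_def)
  \<comment> \<open>A lower bound for the density of the pairs \<open>(z, y)\<close> sharing one
    line: \<open>a / 2\<close> is halved and divided among the subsets of a cube of
    \<open>k ^ m0\<close> words.\<close>
  define \<theta> where "\<theta> = a / 2 / 2 / 2 ^ (k ^ m0)"
  have \<theta>: "0 < \<theta>" "\<theta> \<le> 1/2"
  proof -
    show "0 < \<theta>" using a0 by (simp add: \<theta>_def)
    have "\<theta> \<le> a / 2 / 2 / 1" unfolding \<theta>_def using a0 by (intro divide_left_mono) auto
    then show "\<theta> \<le> 1/2" using a by simp
  qed
  \<comment> \<open>The gain is \<open>a * \<theta>\<close>. Three portions \<open>\<gamma>\<close>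
    of it are lost, to the sections, to the words without top letter and to the threshold
    \<open>a + \<gamma>\<close>; the fourth remains.\<close>
  define \<gamma> where "\<gamma> = a * \<theta> / 4"
  have \<gamma>: "0 < \<gamma>" "\<gamma> \<le> a / 2" using a0 \<theta> by (simp_all add: \<gamma>_def)
  obtain m1 where m1: "\<And>I A. finite I \<Longrightarrow> m1 \<le> card I \<Longrightarrow>
      a + \<gamma> \<le> mean (cube (Suc k) I) (\<lambda>x. of_bool (A x)) \<Longrightarrow> has_line (Suc k) I A"
    using above[OF \<gamma>(1)] by (auto simp: dhj_def)
  have \<gamma>k: "0 < \<gamma> / k" using \<gamma> k by simp
  have mdhj: "mdhj k m b" if "0 < b" for m b using mdhj_of_dhj[OF k dhj that] .
  \<comment> \<open>The conclusion of \<open>insensitive_inter_increment\<close>, named so that a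
    dimension \<open>n2 i\<close> can be chosen for each number \<open>i\<close> of insensitive
    sets.\<close>
  define incr where "incr i N \<longleftrightarrow> (\<forall>I J g E. finite I \<longrightarrow> N \<le> card I \<longrightarrow> finite J \<longrightarrow> card J = m1 \<longrightarrow>
     (\<forall>c<i. insensitive k I c (E c)) \<longrightarrow> (\<forall>x. g x \<le> 1) \<longrightarrow>
     \<gamma> / k \<le> mean (cube (Suc k) I) (\<lambda>x. g x * of_bool (\<forall>c<i. E c x)) \<longrightarrow>
     (\<exists>\<tau>. template (Suc k) J I \<tau> \<and> 0 < mean (cube (Suc k) J) (\<lambda>w. g (inst \<tau> w))))" for i N
  have "\<exists>N. incr i N" if "i \<le> k" for i
  proof (rule insensitive_inter_increment[OF that k mdhj \<gamma>k, where m = m1], goal_cases)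
    case (2 N)
    have "incr i N" unfolding incr_def by (intro allI impI, rule 2) auto
    then show ?case by blast
  qed
  then obtain n2 where n2: "\<And>i. i \<le> k \<Longrightarrow> incr i (n2 i)" by metis
  obtain n3 where n3: "\<And>I. finite I \<Longrightarrow> n3 \<le> card I \<Longrightarrow>
      mean (cube (Suc k) I) (\<lambda>x. of_bool (card {i \<in> I. x i = k} < 1)) \<le> \<gamma>"
    using few_occurrences[of k "Suc k" "\<lambda>l. l = k" \<gamma> 1] \<gamma>(1) by auto
  define s where "s = Max (insert n3 (n2 ` {..k}))"
  have s: "n3 \<le> s" "\<And>i. i \<le> k \<Longrightarrow> n2 i \<le> s" unfolding s_def by (intro Max_ge; simp)+
  define r where "r = m0 * s"
  \<comment> \<open>\<open>mean_all_large\<close>, applied to the \<open>Suc k ^ r\<close> words on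
    \<open>I1\<close>, then loses exactly \<open>\<gamma>\<close>.\<close>
  define e where "e = \<gamma> / (2 * Suc k ^ r)"
  have e: "0 < e" "2 * Suc k ^ r * e = \<gamma>" using \<gamma> by (simp_all add: e_def)
  obtain n4 where n4: "\<And>I A. finite I \<Longrightarrow> n4 \<le> card I \<Longrightarrow>
      a + e \<le> mean (cube (Suc k) I) (\<lambda>x. of_bool (A x)) \<Longrightarrow> has_line (Suc k) I A"
    using above[OF e(1)] by (auto simp: dhj_def)
  obtain I A where I: "finite I" "n4 + r \<le> card I"
    and dens: "a - e \<le> mean (cube (Suc k) I) (\<lambda>x. of_bool (A x))" and no_line: "\<not> has_line (Suc k) I A"
    using below[OF e(1)] unfolding dhj_def by blast
  obtain I1 where I1: "I1 \<subseteq> I" "card I1 = r" "finite I1"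
    using obtain_subset_with_card_n[of r I] I(2) by (metis add_leD2)
  define I2 where "I2 = I - I1"
  have I2: "finite I2" "n4 \<le> card I2" using I I1 by (auto simp: I2_def card_Diff_subset)
  define X where "X = cube (Suc k) I1"
  define Y where "Y = cube (Suc k) I2"
  have X: "finite X" "X \<noteq> {}" and Y: "finite Y" "Y \<noteq> {}"
    using I1 I2 by (simp_all add: X_def Y_def finite_cube cube_ne)
  have I12: "I - I2 = I1" "I2 \<subseteq> I" using I1 by (auto simp: I2_def)

  \<comment> \<open>A section denser than \<open>a + e\<close> contains a line, as at least
    \<open>n4\<close> coordinates remain; with the average at least \<open>a - e\<close>, no section
    is much sparser.\<close>
  have section_dens: "a - \<gamma> \<le> mean Y (\<lambda>y. of_bool (A (glue I1 x y)))" if x: "x \<in> X" for x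
  proof -
    have "a - 2 * card X * e \<le> mean Y (\<lambda>y. of_bool (A (glue I1 x y)))"
    proof (rule mean_all_large[OF X(1) x _ _ less_imp_le[OF e(1)]])
      show "a - e \<le> mean X (\<lambda>x. mean Y (\<lambda>y. of_bool (A (glue I1 x y))))"
        using dens unfolding mean_cube_split'[OF I1(1)] X_def Y_def I2_def .
      fix x assume x: "x \<in> X"
      show "mean Y (\<lambda>y. of_bool (A (glue I1 x y))) \<le> a + e"
      proof (rule ccontr)
        assume "\<not> ?thesis"
        then have "has_line (Suc k) I2 (\<lambda>y. A (glue I1 x y))"
          using n4[OF I2] by (simp add: Y_def)
        then obtain \<tau> where \<tau>: "template (Suc k) {0} I2 \<tau>" "\<forall>c<Suc k. A (glue I1 x (inst \<tau> (\<lambda>_. c)))"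
          by (auto simp: has_line_def)
        have x': "template (Suc k) I2 I (fill I2 x)"
          using template_fill'[OF I12(2)] x by (simp add: I12 X_def)
        have "inst (tcomp (fill I2 x) \<tau>) (\<lambda>_. c) = glue I1 x (inst \<tau> (\<lambda>_. c))" for c
        proof
          fix i show "inst (tcomp (fill I2 x) \<tau>) (\<lambda>_. c) i = glue I1 x (inst \<tau> (\<lambda>_. c)) i"
          proof (cases "i \<in> I")
            case True
            then show ?thesis by (simp add: inst_tcomp inst_fill glue_def I2_def)
          next
            case False
            then have "i \<notin> I1" "i \<notin> I2" using I1 by (auto simp: I2_def)
            moreover have "\<tau> i = Inl 0"
              using template_Inl[OF \<tau>(1), of i] template_Inr[OF \<tau>(1), of i] \<open>i \<notin> I2\<close> by (cases "\<tau> i") auto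
            ultimately show ?thesis
              using cube_0[of x "Suc k" I1 i] x unfolding inst_tcomp inst_fill
              by (simp add: glue_def X_def inst_def)
          qed
        qed
        then have "has_line (Suc k) I A"
          unfolding has_line_def using template_tcomp[OF x' \<tau>(1)] \<tau>(2)
          by (intro exI[of _ "tcomp (fill I2 x) \<tau>"]) simp
        with no_line show False ..
      qed
    qed
    moreover have "2 * card X * e = \<gamma>"
      using e(2) by (simp add: X_def card_cube I1)
    ultimately show ?thesis by simp
  qed

  obtain h where h: "\<And>i. i \<in> I1 \<Longrightarrow> h i < m0" "\<And>j. j < m0 \<Longrightarrow> card {i \<in> I1. h i = j} = s"
    using partition_into_blocks[OF I1(3), of m0 s] I1(2) by (auto simp: r_def)
  define W where "W = cube k {..<m0}"
  have W: "finite W" "W \<noteq> {}" "card W = k ^ m0" using k by (simp_all add: W_def finite_cube cube_ne card_cube)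
  \<comment> \<open>\<open>w\<close> runs through the random subspace given by \<open>z\<close>. It
    is degenerate if some block of \<open>z\<close> has no top letter, which is harmless because
    only membership in \<open>X\<close> is required of \<open>rep z w\<close>.\<close>
  define rep where "rep z w = (\<lambda>i. if z i = k then w (h i) else z i)" for z and w :: "nat \<Rightarrow> nat"
  have rep: "rep z w \<in> X" if z: "z \<in> X" and w: "w \<in> W" for z w
    unfolding X_def
  proof (rule cubeI)
    fix i assume "i \<in> I1"
    then show "rep z w i < Suc k"
      using cube_less[OF z[unfolded X_def], of i] cube_less[OF w[unfolded W_def], of "h i"] h(1)[of i]
      by (auto simp: rep_def)
  next
    fix i assume "i \<notin> I1"
    then show "rep z w i = 0" using cube_0[OF z[unfolded X_def], of i] k by (simp add: rep_def)
  qed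
  have "\<exists>U\<subseteq>W. (\<exists>\<tau>. template k {0} {..<m0} \<tau> \<and> U = (\<lambda>c. inst \<tau> (\<lambda>_. c)) ` {..<k}) \<and>
      a / 2 / 2 / 2 ^ card W \<le> mean (X \<times> Y) (\<lambda>zy. of_bool (\<forall>u\<in>U. A (glue I1 (rep (fst zy) u) (snd zy))))"
  proof (rule popular_subset[OF W(1,2)])
    have "a / 2 \<le> mean W (\<lambda>w. mean X (\<lambda>z. mean Y (\<lambda>y. of_bool (A (glue I1 (rep z w) y)))))"
    proof -
      have "a / 2 = mean W (\<lambda>w. mean X (\<lambda>z. a / 2))" using W X by (simp add: mean_const)
      also have "\<dots> \<le> mean W (\<lambda>w. mean X (\<lambda>z. mean Y (\<lambda>y. of_bool (A (glue I1 (rep z w) y)))))"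
        using section_dens[OF rep] \<gamma>(2) by (intro mean_mono) (force intro: order_trans[rotated])
      finally show ?thesis .
    qed
    then show "a / 2 \<le> mean (X \<times> Y) (\<lambda>zy. mean W (\<lambda>w. of_bool (A (glue I1 (rep (fst zy) w) (snd zy)))))"
      unfolding mean_Times mean_swap[of W] fst_conv snd_conv .
    fix zy assume "a / 2 / 2 \<le> mean W (\<lambda>w. of_bool (A (glue I1 (rep (fst zy) w) (snd zy))))"
    then have "has_line k {..<m0} (\<lambda>w. A (glue I1 (rep (fst zy) w) (snd zy)))"
      using m0[of "{..<m0}"] by (simp add: W_def)
    then obtain \<tau> where \<tau>: "template k {0} {..<m0} \<tau>"
      "\<forall>c<k. A (glue I1 (rep (fst zy) (inst \<tau> (\<lambda>_. c))) (snd zy))"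
      by (auto simp: has_line_def)
    then show "\<exists>U\<subseteq>W. (\<exists>\<tau>. template k {0} {..<m0} \<tau> \<and> U = (\<lambda>c. inst \<tau> (\<lambda>_. c)) ` {..<k}) \<and>
        (\<forall>u\<in>U. A (glue I1 (rep (fst zy) u) (snd zy)))"
      using inst_line_in_cube[OF \<tau>(1)]
      by (intro exI[of _ "(\<lambda>c. inst \<tau> (\<lambda>_. c)) ` {..<k}"]) (auto simp: W_def)
  qed (use X Y a0 in auto)
  then obtain \<tau> where \<tau>: "template k {0} {..<m0} \<tau>"
    and dens_lines: "\<theta> \<le> mean X (\<lambda>z. mean Y (\<lambda>y. of_bool (\<forall>c<k. A (glue I1 (rep z (inst \<tau> (\<lambda>_. c))) y))))"
    unfolding W(3) \<theta>_def[symmetric] mean_Times by (fastforce simp: lessThan_def)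
  obtain j0 where j0: "\<tau> j0 = Inr 0" using template_ex[OF \<tau>] by blast
  then have "j0 < m0" using template_Inr[OF \<tau> j0] by simp
  \<comment> \<open>The blocks belonging to the wildcard of the line. The coordinates of
    \<open>I1\<close> outside \<open>V\<close> are frozen at a good value \<open>z2\<close>.\<close>
  define V where "V = {i \<in> I1. \<tau> (h i) = Inr 0}"
  have V: "V \<subseteq> I1" "finite V" using I1(3) by (auto simp: V_def)
  have card_V: "s \<le> card V"
    unfolding h(2)[OF \<open>j0 < m0\<close>, symmetric] using j0 by (intro card_mono V) (auto simp: V_def)
  define Z where "Z = cube (Suc k) V"
  have Z: "finite Z" "Z \<noteq> {}" using V by (simp_all add: Z_def finite_cube cube_ne)
  obtain z2 where z2: "z2 \<in> cube (Suc k) (I1 - V)"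
    and dens_z2: "\<theta> \<le> mean Z (\<lambda>z. mean Y (\<lambda>y. of_bool (\<forall>c<k. A (glue I1 (rep (glue V z z2) (inst \<tau> (\<lambda>_. c))) y))))"
    using mean_ge_imp_ex[OF finite_cube cube_ne dens_lines[unfolded X_def mean_cube_split[OF V(1)]]] I1(3)
    by (auto simp: Z_def)
  \<comment> \<open>Off \<open>V\<close> the line is constant: its fixed letters replace the top
    letters of \<open>z2\<close>. The default for \<open>Inr\<close> does not occur on
    \<open>I1 - V\<close>.\<close>
  define x0 where "x0 i = (if z2 i = k then case \<tau> (h i) of Inl l \<Rightarrow> l | Inr _ \<Rightarrow> 0 else z2 i)" for i
  have x0: "x0 \<in> cube (Suc k) (I1 - V)"
  proof (rule cubeI)
    fix i assume i: "i \<in> I1 - V"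
    have "\<tau> (h i) \<noteq> Inr 0" using i by (auto simp: V_def)
    then obtain l where "\<tau> (h i) = Inl l" using template_Inr[OF \<tau>, of "h i"] by (cases "\<tau> (h i)") auto
    then show "x0 i < Suc k"
      using template_Inl[OF \<tau>, of "h i" l] h(1)[of i] i cube_less[OF z2 i] by (auto simp: x0_def)
  next
    fix i assume "i \<notin> I1 - V"
    then show "x0 i = 0" using cube_0[OF z2] k by (simp add: x0_def)
  qed
  \<comment> \<open>The point \<open>c\<close> of the line arises from \<open>z\<close> by
    substituting \<open>c\<close> for the top letter on \<open>V\<close>. This is what makes
    \<open>D c\<close> insensitive.\<close>
  have rep_eq: "rep (glue V z z2) (inst \<tau> (\<lambda>_. c)) = glue V (subst_top k c z) x0" for z c
  proof
    fix i
    show "rep (glue V z z2) (inst \<tau> (\<lambda>_. c)) i = glue V (subst_top k c z) x0 i"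
    proof (cases "i \<in> V")
      case True
      then show ?thesis by (simp add: rep_def glue_def subst_top_def inst_def V_def)
    next
      case False
      show ?thesis
      proof (cases "i \<in> I1")
        case True
        then have "\<tau> (h i) \<noteq> Inr 0" using False by (auto simp: V_def)
        then obtain l where "\<tau> (h i) = Inl l" using template_Inr[OF \<tau>, of "h i"] by (cases "\<tau> (h i)") auto
        then show ?thesis using False by (simp add: rep_def glue_def x0_def inst_def)
      next
        case False
        then have "i \<notin> V" "i \<notin> I1 - V" using V by auto
        then show ?thesis using cube_0[OF z2, of i] k by (simp add: rep_def glue_def x0_def)
      qed
    qed
  qed
  define pt where "pt z y = glue I1 (glue V z x0) y" for z y
  define D where "D c y z \<longleftrightarrow> A (pt (subst_top k c z) y)" for c y z
  have dens_D: "\<theta> \<le> mean Z (\<lambda>z. mean Y (\<lambda>y. of_bool (\<forall>c<k. D c y z)))"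
    using dens_z2 unfolding rep_eq D_def pt_def .
  have V_in: "template (Suc k) V I (tcomp (fill I1 y) (fill V x0))" if "y \<in> Y" for y
    using template_tcomp[OF template_fill'[OF I1(1), of y "Suc k"] template_fill'[OF V(1) x0]] that
    by (simp add: Y_def I2_def)
  have inst_pt: "inst (tcomp (fill I1 y) (fill V x0)) z = pt z y" for z y
    by (simp add: inst_tcomp inst_fill pt_def)
  \<comment> \<open>The words \<open>subst_top k c z\<close> for \<open>c < k\<close>, together with
    \<open>z\<close> itself, form the line whose wildcards sit at the top letters of
    \<open>z\<close>.\<close>
  have D_top: "\<not> (A (pt z y) \<and> (\<forall>c<k. D c y z))" if z: "z \<in> Z" and y: "y \<in> Y" and i: "i \<in> V" "z i = k" for z y i
  proof
    assume AD: "A (pt z y) \<and> (\<forall>c<k. D c y z)"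
    define \<sigma> :: "nat \<Rightarrow> nat + nat" where "\<sigma> i = (if z i = k then Inr 0 else Inl (z i))" for i
    have \<sigma>: "template (Suc k) {0} V \<sigma>"
      using i cube_less[OF z[unfolded Z_def]] cube_0[OF z[unfolded Z_def]] k
      by (force simp: template_def \<sigma>_def)
    have "inst \<sigma> (\<lambda>_. c) = subst_top k c z" for c
      by (auto simp: inst_def \<sigma>_def subst_top_def)
    moreover have "subst_top k k z = z" by (auto simp: subst_top_def)
    ultimately have "\<forall>c<Suc k. A (pt (inst \<sigma> (\<lambda>_. c)) y)"
      using AD by (auto simp: D_def less_Suc_eq)
    then have "has_line (Suc k) V (\<lambda>z. A (pt z y))"
      unfolding has_line_def using \<sigma> by blast
    then have "has_line (Suc k) I A"
      using has_line_inst[OF V_in[OF y], of A] by (simp add: inst_pt)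
    with no_line show False ..
  qed
  have dens_AD: "mean Z (\<lambda>z. mean Y (\<lambda>y. of_bool (A (pt z y) \<and> (\<forall>c<k. D c y z)))) \<le> \<gamma>"
  proof -
    have "mean Z (\<lambda>z. mean Y (\<lambda>y. of_bool (A (pt z y) \<and> (\<forall>c<k. D c y z))))
        \<le> mean Z (\<lambda>z. mean Y (\<lambda>y. of_bool (card {i \<in> V. z i = k} < 1)))"
    proof (intro mean_mono)
      fix z y assume zy: "z \<in> Z" "y \<in> Y"
      show "of_bool (A (pt z y) \<and> (\<forall>c<k. D c y z)) \<le> (of_bool (card {i \<in> V. z i = k} < 1) :: real)"
      proof (cases "card {i \<in> V. z i = k} < 1")
        case False
        then have "{i \<in> V. z i = k} \<noteq> {}" by (metis card.empty less_one)
        then show ?thesis using D_top[OF zy] by auto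
      qed simp
    qed
    also have "\<dots> \<le> \<gamma>"
      using n3[OF V(2)] card_V s(1) Y by (simp add: mean_const Z_def)
    finally show ?thesis .
  qed
  have dens_A: "a - \<gamma> \<le> mean Z (\<lambda>z. mean Y (\<lambda>y. of_bool (A (pt z y))))"
  proof -
    have "mean Z (\<lambda>_. a - \<gamma>) \<le> mean Z (\<lambda>z. mean Y (\<lambda>y. of_bool (A (pt z y))))"
    proof (rule mean_mono)
      fix z assume "z \<in> Z"
      then have "glue V z x0 \<in> X"
        unfolding X_def Z_def using glue_in_cube'[OF V(1) _ x0] by blast
      then show "a - \<gamma> \<le> mean Y (\<lambda>y. of_bool (A (pt z y)))" unfolding pt_def by (rule section_dens)
    qed
    then show ?thesis using Z by (simp add: mean_const)
  qed
  define g where "g y z = of_bool (A (pt z y)) - (a + \<gamma>)" for y z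
  define F where "F i y z \<longleftrightarrow> (\<forall>c<i. D c y z) \<and> \<not> D i y z" for i y z
  have "\<gamma> \<le> mean Z (\<lambda>z. mean Y (\<lambda>y. g y z * of_bool (\<not> (\<forall>c<k. D c y z))))"
  proof -
    have eq: "g y z * of_bool (\<not> (\<forall>c<k. D c y z)) = of_bool (A (pt z y))
        - of_bool (A (pt z y) \<and> (\<forall>c<k. D c y z)) - (a + \<gamma>) + (a + \<gamma>) * of_bool (\<forall>c<k. D c y z)" for y z
      by (cases "\<forall>c<k. D c y z"; cases "A (pt z y)") (auto simp: g_def)
    have "mean Z (\<lambda>z. mean Y (\<lambda>y. g y z * of_bool (\<not> (\<forall>c<k. D c y z))))
        = mean Z (\<lambda>z. mean Y (\<lambda>y. of_bool (A (pt z y))))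
          - mean Z (\<lambda>z. mean Y (\<lambda>y. of_bool (A (pt z y) \<and> (\<forall>c<k. D c y z))))
          - (a + \<gamma>) + (a + \<gamma>) * mean Z (\<lambda>z. mean Y (\<lambda>y. of_bool (\<forall>c<k. D c y z)))"
      unfolding eq mean_add mean_diff mean_cmult mean_const[OF Y] mean_const[OF Z] ..
    also have "\<dots> \<ge> (a - \<gamma>) - \<gamma> - (a + \<gamma>) + (a + \<gamma>) * \<theta>"
      using dens_A dens_AD dens_D a0 \<gamma> by (intro add_mono diff_mono mult_left_mono) auto
    also have "(a - \<gamma>) - \<gamma> - (a + \<gamma>) + (a + \<gamma>) * \<theta> = \<gamma> + \<gamma> * \<theta>"
      by (simp add: \<gamma>_def algebra_simps)
    finally have "\<gamma> + \<gamma> * \<theta> \<le> mean Z (\<lambda>z. mean Y (\<lambda>y. g y z * of_bool (\<not> (\<forall>c<k. D c y z))))" .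
    moreover have "0 \<le> \<gamma> * \<theta>" using \<gamma> \<theta> by simp
    ultimately show ?thesis by linarith
  qed
  also have "\<dots> = (\<Sum>i<k. mean Z (\<lambda>z. mean Y (\<lambda>y. g y z * of_bool (F i y z))))"
    unfolding sum_first_failure[symmetric] F_def sum_distrib_left mean_sum ..
  finally have total: "\<gamma> \<le> (\<Sum>i<k. mean Z (\<lambda>z. mean Y (\<lambda>y. g y z * of_bool (F i y z))))" .
  have "\<exists>i\<in>{..<k}. \<gamma> / k \<le> mean Z (\<lambda>z. mean Y (\<lambda>y. g y z * of_bool (F i y z)))"
    using total k by (intro mean_ge_imp_ex) (auto simp: mean_def divide_right_mono)
  then obtain i where i: "i < k" and dens_i: "\<gamma> / k \<le> mean Z (\<lambda>z. mean Y (\<lambda>y. g y z * of_bool (F i y z)))"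
    by blast
  then obtain y where y: "y \<in> Y" and dens_y: "\<gamma> / k \<le> mean Z (\<lambda>z. g y z * of_bool (F i y z))"
    using mean_ge_imp_ex[OF Y dens_i[unfolded mean_swap[of Z]]] by blast
  define E where "E c z \<longleftrightarrow> (if c < i then D c y z else \<not> D c y z)" for c z
  have E: "insensitive k V c (E c)" if "c < Suc i" for c
  proof -
    have "subst_top k c (subst_top k c z) = subst_top k c z" for z
      using that i by (auto simp: subst_top_def)
    then show ?thesis by (simp add: insensitive_def E_def D_def)
  qed
  have F_E: "F i y z \<longleftrightarrow> (\<forall>c<Suc i. E c z)" for z
    by (auto simp: F_def E_def less_Suc_eq)
  have g1: "g y z \<le> 1" for z using a0 \<gamma> by (simp add: g_def)
  have "incr (Suc i) (n2 (Suc i))" using n2 i by simp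
  note this[unfolded incr_def, THEN spec[of _ V], THEN spec[of _ "{..<m1}"], THEN spec[of _ "g y"], THEN spec[of _ E]]
  moreover have "n2 (Suc i) \<le> card V" using s(2)[of "Suc i"] i card_V by simp
  ultimately obtain \<rho> where \<rho>: "template (Suc k) {..<m1} V \<rho>"
    "0 < mean (cube (Suc k) {..<m1}) (\<lambda>w. g y (inst \<rho> w))"
    using V(2) E g1 dens_y[unfolded F_E Z_def] by auto
  have "a + \<gamma> \<le> mean (cube (Suc k) {..<m1}) (\<lambda>w. of_bool (A (pt (inst \<rho> w) y)))"
    using \<rho>(2) by (simp add: g_def mean_diff mean_const finite_cube cube_ne)
  then have "has_line (Suc k) {..<m1} (\<lambda>w. A (pt (inst \<rho> w) y))"
    by (intro m1) auto
  then have "has_line (Suc k) V (\<lambda>z. A (pt z y))" by (rule has_line_inst[OF \<rho>(1)])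
  then have "has_line (Suc k) I A"
    using has_line_inst[OF V_in[OF y], of A] by (simp add: inst_pt)
  with no_line show False ..
qed

theorem density_Hales_Jewett:
  assumes "0 < k" "0 < b"
  shows "dhj k b"
  using assms
proof (induction k arbitrary: b rule: nat_induct_non_zero)
  case 1
  \<comment> \<open>A one-letter cube is a single word, and making every coordinate a wildcard gives
    a line once there is a coordinate at all.\<close>
  have "has_line 1 I A" if I: "finite I" "1 \<le> card I" and A: "b \<le> mean (cube 1 I) (\<lambda>x. of_bool (A x))" for I A
  proof -
    have "I \<noteq> {}" using I by auto
    have zero: "x = (\<lambda>_. 0)" if "x \<in> cube 1 I" for x
      using cube_less[OF that] cube_0[OF that] by fastforce
    obtain x where "x \<in> cube 1 I" "b \<le> of_bool (A x)"
      using mean_ge_imp_ex[OF finite_cube[OF I(1)] cube_ne A] by auto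
    with zero 1 have A0: "A (\<lambda>_. 0)" by (cases "A x") auto
    define \<tau> :: "nat \<Rightarrow> nat + nat" where "\<tau> i = (if i \<in> I then Inr 0 else Inl 0)" for i
    have "template 1 {0} I \<tau>" using \<open>I \<noteq> {}\<close> by (auto simp: template_def \<tau>_def)
    moreover have "inst \<tau> (\<lambda>_. 0) = (\<lambda>_. 0)" by (auto simp: inst_def \<tau>_def)
    ultimately show ?thesis using A0 by (auto simp: has_line_def)
  qed
  then show ?case unfolding dhj_def by blast
next
  case (Suc k)
  then show ?case by (intro dhj_Suc) auto
qed

section \<open>Multiple recurrence\<close>

lemma finite_templates: "finite I \<Longrightarrow> finite J \<Longrightarrow> finite {\<tau>. template k J I \<tau>}"
proof (rule finite_subset)
  assume "finite I" "finite J"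
  then show "finite {\<tau>. \<forall>i. (i \<in> I \<longrightarrow> \<tau> i \<in> Inl ` {..<k} \<union> Inr ` J) \<and> (i \<notin> I \<longrightarrow> \<tau> i = Inl (0::nat))}"
    by (intro finite_set_of_finite_funs) auto
  show "{\<tau>. template k J I \<tau>}
      \<subseteq> {\<tau>. \<forall>i. (i \<in> I \<longrightarrow> \<tau> i \<in> Inl ` {..<k} \<union> Inr ` J) \<and> (i \<notin> I \<longrightarrow> \<tau> i = Inl (0::nat))}"
  proof clarify
    fix \<tau> i assume "template k J I \<tau>"
    then show "(i \<in> I \<longrightarrow> \<tau> i \<in> Inl ` {..<k} \<union> Inr ` J) \<and> (i \<notin> I \<longrightarrow> \<tau> i = Inl 0)"
      using template_Inl[of k J I \<tau> i] template_Inr[of k J I \<tau> i] by (cases "\<tau> i") auto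
  qed
qed

lemma sum_scaled_basis_const: "(\<Sum>i\<in>S. scaled_basis r a) = scaled_basis (r * card S) a"
  unfolding vec_eq_iff sum_component scaled_basis_def by simp

lemma Zd_system_space: "Zd_system M T \<Longrightarrow> space M = UNIV"
  using sets_eq_imp_space_eq[of M borel] by (simp add: Zd_system_def)

lemma Zd_system_vimage:
  assumes "Zd_system M T" "A \<in> sets M"
  shows "T m -` A \<in> sets M" "measure M (T m -` A) = measure M A"
proof -
  have T: "T m \<in> measurable M M" "distr M M (T m) = M" using assms(1) by (auto simp: Zd_system_def)
  show "T m -` A \<in> sets M"
    using measurable_sets[OF T(1) assms(2)] Zd_system_space[OF assms(1)] by simp
  show "measure M (T m -` A) = measure M A"
    using measure_distr[OF T(1) assms(2)] T(2) Zd_system_space[OF assms(1)] by simp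
qed

lemma Zd_system_add: "Zd_system M T \<Longrightarrow> T (m + n) x = T m (T n x)"
  unfolding Zd_system_def using Zd_system_space[of M T, unfolded Zd_system_def] by blast

text \<open>The finitary statement of the density Hales--Jewett theorem gives constants independent of \<open>r\<close>.\<close>

lemma uniform_multiple_recurrence:
  fixes T :: "int ^ 'd \<Rightarrow> 'a::polish_space \<Rightarrow> 'a"
  assumes sys: "Zd_system M T" and B: "B \<in> sets M" "0 < measure M B"
  shows "\<exists>N c. 0 < c \<and> (\<forall>r. \<exists>n\<in>{1..N}. c \<le> measure M (\<Inter>i. T (scaled_basis (r * n) i) -` B))"
proof -
  interpret prob_space M using sys by (simp add: Zd_system_def)
  define d where "d = CARD('d)"
  have d: "0 < d" by (simp add: d_def)
  obtain h :: "nat \<Rightarrow> 'd" where "bij_betw h {0..<d} UNIV"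
    unfolding d_def using ex_bij_betw_nat_finite[of "UNIV :: 'd set"] by auto
  then have h: "h ` {..<d} = UNIV" by (simp add: bij_betw_def atLeast0LessThan)
  define b where "b = measure M B"
  have b: "0 < b / 2" using B by (simp add: b_def)
  obtain N where N: "\<And>I A. finite I \<Longrightarrow> N \<le> card I \<Longrightarrow>
      b / 2 \<le> mean (cube d I) (\<lambda>x. of_bool (A x)) \<Longrightarrow> has_line d I A"
    using density_Hales_Jewett[OF d b] by (auto simp: dhj_def)
  define I where "I = {..<N}"
  define C where "C = cube d I"
  have C: "finite C" "C \<noteq> {}" using d by (auto simp: C_def I_def finite_cube cube_ne)
  define F where "F = {\<tau>. template d {0} I \<tau>}"
  have F: "finite F" by (simp add: F_def I_def finite_templates)
  \<comment> \<open>Chosen so that some template must contribute at least \<open>c\<close> to a sum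
    of at least \<open>b / 2\<close>; the added 1 makes the estimate strict even for empty
    \<open>F\<close>.\<close>
  define c where "c = b / 2 / (card F + 1)"
  have c: "0 < c" using b by (simp add: c_def)
  have "\<exists>n\<in>{1..N}. c \<le> measure M (\<Inter>i. T (scaled_basis (r * n) i) -` B)" for r
  proof -
    define q where "q n = measure M (\<Inter>i. T (scaled_basis (r * n) i) -` B)" for n
    define sh where "sh x = (\<Sum>i\<in>I. scaled_basis r (h (x i)))" for x
    define n where "n \<tau> = card {i \<in> I. \<tau> i = Inr (0::nat)}" for \<tau> :: "nat \<Rightarrow> nat + nat"
    define f where "f \<omega> = mean C (\<lambda>x. of_bool (T (sh x) \<omega> \<in> B))" for \<omega>
    \<comment> \<open>Since \<open>f\<close> has integral \<open>b\<close> and is at most 1, the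
      reverse Markov argument gives \<open>G\<close> measure at least \<open>b / 2\<close>.\<close>
    define G where "G = {\<omega>. b / 2 \<le> f \<omega>}"
    define P where "P \<tau> = (\<Inter>a\<in>{..<d}. T (sh (inst \<tau> (\<lambda>_. a))) -` B)" for \<tau>
    have f_alt: "f = (\<lambda>\<omega>. (\<Sum>x\<in>C. indicator (T (sh x) -` B) \<omega>) / card C)"
      by (auto simp: f_def mean_def indicator_def of_bool_def fun_eq_iff intro!: arg_cong[where f = "\<lambda>u. u / _"] sum.cong)
    have ind: "integrable M (indicator (T m -` B) :: _ \<Rightarrow> real)" for m
      using Zd_system_vimage[OF sys B(1)] by (intro integrable_real_indicator) (auto simp: emeasure_eq_measure)
    have int_f: "integrable M f" "integral\<^sup>L M f = b"
    proof -
      show "integrable M f" unfolding f_alt using ind by simp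
      have "integral\<^sup>L M f = (\<Sum>x\<in>C. measure M (T (sh x) -` B)) / card C"
        unfolding f_alt using ind Zd_system_space[OF sys] by (simp add: Bochner_Integration.integral_sum)
      also have "\<dots> = b" using Zd_system_vimage[OF sys B(1)] C by (simp add: b_def)
      finally show "integral\<^sup>L M f = b" .
    qed
    have "{\<omega>\<in>space M. b / 2 \<le> f \<omega>} \<in> sets M"
      using borel_measurable_integrable[OF int_f(1)] by measurable
    then have G: "G \<in> sets M" by (simp add: G_def Zd_system_space[OF sys])
    have ind_G: "integrable M (indicator G :: _ \<Rightarrow> real)"
      using G by (intro integrable_real_indicator) (auto simp: emeasure_eq_measure)
    have "integral\<^sup>L M f \<le> integral\<^sup>L M (\<lambda>\<omega>. b / 2 + indicator G \<omega>)"
    proof (rule integral_mono[OF int_f(1)])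
      show "integrable M (\<lambda>\<omega>. b / 2 + indicator G \<omega>)"
        using ind_G by simp
      fix \<omega>
      have "f \<omega> \<le> 1" unfolding f_def by (rule mean_of_bool_le_1)
      then show "f \<omega> \<le> b / 2 + indicator G \<omega>"
        using b by (auto simp: G_def indicator_def)
    qed
    also have "\<dots> = b / 2 + measure M G"
      using ind_G prob_space Zd_system_space[OF sys] by simp
    finally have "b / 2 \<le> measure M G" by (simp add: int_f(2))
    also have "G \<subseteq> (\<Union>\<tau>\<in>F. P \<tau>)"
    proof
      fix \<omega> assume "\<omega> \<in> G"
      then have "has_line d I (\<lambda>x. T (sh x) \<omega> \<in> B)"
        by (intro N) (simp_all add: I_def G_def f_def C_def)
      then show "\<omega> \<in> (\<Union>\<tau>\<in>F. P \<tau>)" by (auto simp: has_line_def F_def P_def)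
    qed
    have P_sets: "P \<tau> \<in> sets M" for \<tau>
      unfolding P_def using d Zd_system_vimage[OF sys B(1)] by (intro sets.finite_INT) auto
    have "measure M G \<le> measure M (\<Union>\<tau>\<in>F. P \<tau>)"
      using \<open>G \<subseteq> _\<close> P_sets F by (intro finite_measure_mono) auto
    also have "\<dots> \<le> (\<Sum>\<tau>\<in>F. measure M (P \<tau>))"
      using P_sets F by (intro finite_measure_subadditive_finite) auto
    also have "\<dots> = (\<Sum>\<tau>\<in>F. q (n \<tau>))"
    proof (rule sum.cong)
      fix \<tau> assume "\<tau> \<in> F"
      define K where "K = {i \<in> I. \<tau> i = Inr 0}"
      define s where "s = (\<Sum>i\<in>I - K. scaled_basis r (h (inst \<tau> (\<lambda>_. 0) i)))"
      \<comment> \<open>Along a line only the wildcard coordinates vary with \<open>a\<close>. They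
        add up to a multiple of one basis vector, and \<open>s\<close> is common to all
        \<open>a\<close>.\<close>
      have sh: "sh (inst \<tau> (\<lambda>_. a)) = scaled_basis (r * n \<tau>) (h a) + s" for a
      proof -
        have "sh (inst \<tau> (\<lambda>_. a)) = (\<Sum>i\<in>K. scaled_basis r (h (inst \<tau> (\<lambda>_. a) i)))
            + (\<Sum>i\<in>I - K. scaled_basis r (h (inst \<tau> (\<lambda>_. a) i)))"
          unfolding sh_def by (subst sum.subset_diff[of K I]) (auto simp: K_def I_def add.commute)
        also have "(\<Sum>i\<in>K. scaled_basis r (h (inst \<tau> (\<lambda>_. a) i))) = (\<Sum>i\<in>K. scaled_basis r (h a))"
          by (rule sum.cong) (auto simp: K_def inst_def)
        also have "\<dots> = scaled_basis (r * n \<tau>) (h a)"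
          by (simp only: sum_scaled_basis_const n_def K_def)
        also have "(\<Sum>i\<in>I - K. scaled_basis r (h (inst \<tau> (\<lambda>_. a) i))) = s"
          unfolding s_def
        proof (rule sum.cong)
          fix i assume i: "i \<in> I - K"
          then obtain l where "\<tau> i = Inl l"
            using template_Inr[of d "{0}" I \<tau> i] \<open>\<tau> \<in> F\<close> by (cases "\<tau> i") (auto simp: F_def K_def)
          then show "scaled_basis r (h (inst \<tau> (\<lambda>_. a) i)) = scaled_basis r (h (inst \<tau> (\<lambda>_. 0) i))"
            by (simp add: inst_def)
        qed simp
        finally show ?thesis .
      qed
      \<comment> \<open>\<open>P \<tau>\<close> is thus a translate of the common return set, and
        \<open>T s\<close> preserves the measure.\<close>
      have "P \<tau> = T s -` (\<Inter>a\<in>{..<d}. T (scaled_basis (r * n \<tau>) (h a)) -` B)"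
        by (auto simp: P_def sh Zd_system_add[OF sys])
      also have "(\<Inter>a\<in>{..<d}. T (scaled_basis (r * n \<tau>) (h a)) -` B)
          = (\<Inter>i\<in>h ` {..<d}. T (scaled_basis (r * n \<tau>) i) -` B)" by simp
      also have "\<dots> = (\<Inter>i. T (scaled_basis (r * n \<tau>) i) -` B)" unfolding h ..
      finally have P_eq: "P \<tau> = T s -` (\<Inter>i. T (scaled_basis (r * n \<tau>) i) -` B)" .
      have "(\<Inter>i. T (scaled_basis (r * n \<tau>) i) -` B) \<in> sets M"
        using Zd_system_vimage[OF sys B(1)] by (intro sets.finite_INT) auto
      from Zd_system_vimage(2)[OF sys this] show "measure M (P \<tau>) = q (n \<tau>)"
        by (simp add: P_eq q_def)
    qed simp
    finally have sum: "b / 2 \<le> (\<Sum>\<tau>\<in>F. q (n \<tau>))" .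
    have "\<exists>\<tau>\<in>F. c \<le> q (n \<tau>)"
    proof (rule ccontr)
      assume "\<not> ?thesis"
      then have "(\<Sum>\<tau>\<in>F. q (n \<tau>)) \<le> (\<Sum>\<tau>\<in>F. c)" by (intro sum_mono) auto
      also have "\<dots> < (card F + 1) * c" using c by (simp add: algebra_simps)
      also have "\<dots> = b / 2" by (simp add: c_def del: of_nat_Suc)
      finally show False using sum by simp
    qed
    then obtain \<tau> where \<tau>: "\<tau> \<in> F" "c \<le> q (n \<tau>)" by blast
    obtain i where "\<tau> i = Inr 0" "i \<in> I"
      using template_ex[of d "{0}" I \<tau> 0] template_Inr[of d "{0}" I \<tau>] \<tau>(1) by (auto simp: F_def)
    then have "{i \<in> I. \<tau> i = Inr 0} \<noteq> {}" by blast
    then have "1 \<le> n \<tau>" by (simp add: n_def I_def Suc_le_eq card_gt_0_iff)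
    moreover have "n \<tau> \<le> card I" unfolding n_def by (rule card_mono) (auto simp: I_def)
    ultimately show ?thesis
      using \<tau>(2) by (intro bexI[of _ "n \<tau>"]) (auto simp: q_def I_def)
  qed
  then show ?thesis using c by blast
qed

theorem theorem4p1:
  fixes M :: "('a::polish_space) measure"
    and T :: "int ^ 'd \<Rightarrow> 'a \<Rightarrow> 'a"
    and MF :: "('d \<Rightarrow> 'a) measure"
    and A :: "'d \<Rightarrow> 'a set"
  assumes "Zd_system M T"
    and "furstenberg_joining M T MF"
    and "\<And>i. A i \<in> sets M"
    and "measure MF (PiE UNIV A) = 0"
  shows "measure M (\<Inter>i. A i) = 0"
proof (rule ccontr)
  interpret prob_space M using assms(1) by (simp add: Zd_system_def)
  define B where "B = (\<Inter>i. A i)"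
  assume "measure M (\<Inter>i. A i) \<noteq> 0"
  then have B_pos: "0 < measure M B"
    by (simp add: B_def zero_less_measure_iff)
  have B: "B \<in> sets M" unfolding B_def using assms(3) by (intro sets.finite_INT) auto
  define u where "u n = measure M (space M \<inter> (\<Inter>i. T (scaled_basis n i) -` A i))" for n
  have "(\<lambda>N. (\<Sum>n=1..N. u n) / real N) \<longlonglongrightarrow> 0"
    using assms(2)[unfolded furstenberg_joining_def, THEN conjunct2, THEN conjunct2, rule_format, of A] assms(3,4)
    by (simp add: u_def)
  from uniform_multiple_recurrence[OF assms(1) B B_pos] obtain N c where c: "0 < c"
    and rec: "\<And>r. \<exists>n\<in>{1..N}. c \<le> measure M (\<Inter>i. T (scaled_basis (r * n) i) -` B)" by blast
  have "0 < N" using rec[of 0] by auto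
  have rec_u: "\<exists>n\<in>{1..N}. c \<le> u (r * n)" for r
  proof -
    obtain n where n: "n \<in> {1..N}" "c \<le> measure M (\<Inter>i. T (scaled_basis (r * n) i) -` B)"
      using rec by blast
    have "measure M (\<Inter>i. T (scaled_basis (r * n) i) -` B) \<le> u (r * n)"
      unfolding u_def
    proof (rule finite_measure_mono)
      show "(\<Inter>i. T (scaled_basis (r * n) i) -` B) \<subseteq> space M \<inter> (\<Inter>i. T (scaled_basis (r * n) i) -` A i)"
        by (auto simp: Zd_system_space[OF assms(1)] B_def)
      show "space M \<inter> (\<Inter>i. T (scaled_basis (r * n) i) -` A i) \<in> sets M"
        using Zd_system_vimage(1)[OF assms(1,3)] by (intro sets.Int sets.finite_INT) auto
    qed
    then show ?thesis using n by force
  qed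
  have u_nonneg: "0 \<le> u n" for n by (simp add: u_def)
  \<comment> \<open>Every \<open>r \<le> K\<close> contributes at least \<open>c\<close> through
    some \<open>r * n\<close> with \<open>n \<le> N\<close>. For fixed \<open>n\<close> these
    multiples are distinct and at most \<open>K * N\<close>, so each value of \<open>u\<close> is
    counted at most \<open>N\<close> times.\<close>
  have lower: "c / N\<^sup>2 \<le> (\<Sum>n=1..K * N. u n) / real (K * N)" if "0 < K" for K
  proof -
    have "c * K = (\<Sum>r=1..K. c)" by simp
    also have "\<dots> \<le> (\<Sum>r=1..K. \<Sum>n=1..N. u (r * n))"
    proof (rule sum_mono)
      fix r
      obtain n where n: "n \<in> {1..N}" "c \<le> u (r * n)" using rec_u by blast
      then show "c \<le> (\<Sum>n=1..N. u (r * n))"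
        using member_le_sum[of n "{1..N}" "\<lambda>n. u (r * n)"] u_nonneg by fastforce
    qed
    also have "\<dots> = (\<Sum>n=1..N. \<Sum>r=1..K. u (r * n))" by (rule sum.swap)
    also have "\<dots> \<le> (\<Sum>n=1..N. \<Sum>n=1..K * N. u n)"
    proof (rule sum_mono)
      fix n assume n: "n \<in> {1..N}"
      have "(\<Sum>r=1..K. u (r * n)) = sum u ((\<lambda>r. r * n) ` {1..K})"
        using n by (subst sum.reindex) (auto intro!: inj_onI)
      also have "\<dots> \<le> (\<Sum>n=1..K * N. u n)"
        using n u_nonneg by (intro sum_mono2) (auto intro: mult_le_mono)
      finally show "(\<Sum>r=1..K. u (r * n)) \<le> (\<Sum>n=1..K * N. u n)" .
    qed
    also have "\<dots> = N * (\<Sum>n=1..K * N. u n)" by simp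
    finally have "c * K \<le> N * (\<Sum>n=1..K * N. u n)" .
    then show ?thesis
      using \<open>0 < N\<close> that by (simp add: field_simps power2_eq_square)
  qed
  have "\<forall>\<^sub>F L in sequentially. (\<Sum>n=1..L. u n) / real L < c / N\<^sup>2"
    using \<open>(\<lambda>N. (\<Sum>n=1..N. u n) / real N) \<longlonglongrightarrow> 0\<close> c \<open>0 < N\<close> by (intro order_tendstoD(2)) auto
  then obtain L where L: "\<And>L'. L \<le> L' \<Longrightarrow> (\<Sum>n=1..L'. u n) / real L' < c / N\<^sup>2"
    unfolding eventually_sequentially by blast
  have "L \<le> Suc L * N" using \<open>0 < N\<close> by (cases N) auto
  from L[OF this] lower[of "Suc L"] show False by simp
qed

end
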